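(* Let $H\in(0,1)$, $\sigma>0$, $S_0>0$, and let $(S_t)_{t\ge 0}$ be the process $S_t=S_0\exp\big(\sigma(B_t+B^H_t)-\tfrac12\sigma^2(t+t^{2H})\big)$, where $B$ is a standard Brownian motion and $B^H$ is an independent fractional Brownian motion with Hurst parameter $H$. For $N\ge 1$ define $$\hat\sigma^2_N=\frac{1}{N}\Big(\frac1N+\frac1{N^{2H}}\Big)^{-1}\sum_{j=0}^{N-1}\Big(\log\frac{S_{(j+1)/N}}{S_{j/N}}\Big)^2 .$$ Then $\hat\sigma^2_N\to\sigma^2$ almost surely as $N\to\infty$.
   Context: All processes are defined on a common complete probability space $(\Omega,\mathcal F,\mathbb P)$. $B$ is a standard Brownian motion (covariance $s\wedge t$) and $B^H$ is a centered Gaussian fractional Brownian motion with covariance $\frac12(t^{2H}+s^{2H}-|t-s|^{2H})$, independent of $B$. The sum $M_t=B_t+B^H_t$ is the mixed fractional Brownian motion. The observations are the values $S_{j/N}$, $j=0,\dots,N$, of a single path on the equidistant grid of $[0,1]$ with mesh $1/N$ (high-frequency data); the drift parameter is set to $0$. *)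

theory Defs
  imports "HOL-Probability.Probability"
begin

definition centered_gaussian_process ::
  "'a measure \<Rightarrow> real set \<Rightarrow> (real \<Rightarrow> 'a \<Rightarrow> real) \<Rightarrow> (real \<Rightarrow> real \<Rightarrow> real) \<Rightarrow> bool" where
  "centered_gaussian_process M T X K \<longleftrightarrow>
     (\<forall>t\<in>T. X t \<in> borel_measurable M) \<and>
     (\<forall>I c. finite I \<longrightarrow> I \<subseteq> T \<longrightarrow>
        (let v = (\<Sum>s\<in>I. \<Sum>t\<in>I. c s * c t * K s t) in
          if v = 0 then (AE \<omega> in M. (\<Sum>t\<in>I. c t * X t \<omega>) = 0)
          else distributed M lborel (\<lambda>\<omega>. \<Sum>t\<in>I. c t * X t \<omega>)
                 (\<lambda>x. ennreal (normal_density 0 (sqrt v) x))))"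

definition brownian_motion :: "'a measure \<Rightarrow> (real \<Rightarrow> 'a \<Rightarrow> real) \<Rightarrow> bool" where
  "brownian_motion M B \<longleftrightarrow> centered_gaussian_process M {0..} B (\<lambda>s t. min s t)"

definition fractional_brownian_motion ::
  "'a measure \<Rightarrow> real \<Rightarrow> (real \<Rightarrow> 'a \<Rightarrow> real) \<Rightarrow> bool" where
  "fractional_brownian_motion M H BH \<longleftrightarrow> centered_gaussian_process M {0..} BH
     (\<lambda>s t. (t powr (2*H) + s powr (2*H) - \<bar>t - s\<bar> powr (2*H)) / 2)"

text \<open>Path map of a process on [0,oo), as a random element of the product space.\<close>
definition path :: "(real \<Rightarrow> 'a \<Rightarrow> real) \<Rightarrow> 'a \<Rightarrow> real \<Rightarrow> real" where
  "path X \<omega> = restrict (\<lambda>t. X t \<omega>) {0..}"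

definition gmfbm_price ::
  "real \<Rightarrow> real \<Rightarrow> real \<Rightarrow> (real \<Rightarrow> 'a \<Rightarrow> real) \<Rightarrow> (real \<Rightarrow> 'a \<Rightarrow> real) \<Rightarrow> real \<Rightarrow> 'a \<Rightarrow> real" where
  "gmfbm_price S0 \<sigma> H B BH t \<omega> =
     S0 * exp (\<sigma> * (B t \<omega> + BH t \<omega>) - \<sigma>\<^sup>2 / 2 * (t + t powr (2*H)))"

definition sigma_hat_sq :: "real \<Rightarrow> (real \<Rightarrow> 'a \<Rightarrow> real) \<Rightarrow> nat \<Rightarrow> 'a \<Rightarrow> real" where
  "sigma_hat_sq H S N \<omega> =
     1 / real N * inverse (1 / real N + 1 / real N powr (2*H)) *
     (\<Sum>j<N. (ln (S (real (j+1) / real N) \<omega> / S (real j / real N) \<omega>))\<^sup>2)"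

end

theory Submission
  imports Defs
begin

text \<open>
  Let \<open>Z\<close> be the vector of the \<open>N\<close> increments of \<open>B + B\<^sup>H\<close>, with covariance matrix \<open>C\<close>, whose diagonal
  entries are all \<open>c = 1/N + N powr (-2H)\<close>, and let \<open>Z'\<close> be an independent copy. Since \<open>(Z + Z')/\<surd>2\<close> and \<open>(Z - Z')/\<surd>2\<close>
  are again two independent copies of \<open>Z\<close>, Jensen's inequality gives
  \<open>E(|Z|\<^sup>2 - Nc)^4 \<le> E(|Z'|\<^sup>2 - |Z|\<^sup>2)^4 = 16 E(Z \<bullet> Z')^4 = 48 E(Z \<bullet> C Z)\<^sup>2 \<le> 144 \<kappa>\<^sup>2 (Nc)\<^sup>2\<close>,
  where \<open>\<kappa>\<close> is the largest absolute row sum of \<open>C\<close>. The covariances of the fractional increments at positive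
  lag are all of one sign and telescope, so \<open>\<kappa> \<le> 3c\<close> for every \<open>H\<close>. Hence \<open>|Z|\<^sup>2/(Nc) - 1\<close> has fourth moment
  \<open>O(1/N\<^sup>2)\<close>, which is summable, and \<open>|Z|\<^sup>2/(Nc)\<close> converges to \<open>1\<close> almost surely. The squared drift increments
  contribute only \<open>O(1/N)\<close>, and the cross term vanishes by the Cauchy-Schwarz inequality.
\<close>

subsection \<open>Moments and polarization\<close>

text \<open>The alternating sum over subsets is an iterated finite difference of the polynomial
  \<open>c ^ m\<close>; each difference lowers the degree by one, so only a leading term can
  survive. This expresses a product through powers of sums and so reduces mixed moments to moments
  of single variables. The shift \<open>c\<close> is general because adding \<open>a\<close> to a
  subset replaces \<open>c\<close> by \<open>c + x a\<close>.\<close>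

lemma polarization:
  fixes x :: "'b \<Rightarrow> real"
  assumes "finite A" "m \<le> card A"
  shows "(\<Sum>S\<in>Pow A. (-1) ^ card S * (c + sum x S) ^ m) =
    (if m = card A then (-1) ^ m * fact m * prod x A else 0)"
  using assms
proof (induction A arbitrary: m c rule: finite_induct)
  case empty
  then show ?case by simp
next
  case (insert a A)
  let ?D = "\<lambda>k d. \<Sum>S\<in>Pow A. (-1) ^ card S * (d + sum x S) ^ k"
  have inj: "inj_on (insert a) (Pow A)"
    using insert.hyps by (auto simp: inj_on_def)
  have disj: "Pow A \<inter> insert a ` Pow A = {}"
    using insert.hyps by auto
  have step: "(-1) ^ card (insert a S) * (c + sum x (insert a S)) ^ m =
      - ((-1) ^ card S * ((c + x a) + sum x S) ^ m)" if S: "S \<in> Pow A" for S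
  proof -
    have "finite S" "a \<notin> S" using S insert.hyps finite_subset[of S A] by auto
    then show ?thesis by (simp add: add_ac)
  qed
  have "(\<Sum>S\<in>Pow (insert a A). (-1) ^ card S * (c + sum x S) ^ m) =
      ?D m c - ?D m (c + x a)"
    unfolding Pow_insert using insert.hyps disj inj
    by (subst sum.union_disjoint) (auto simp: sum.reindex step sum_negf)
  also have "?D m (c + x a) = (\<Sum>k\<le>m. (m choose k) * x a ^ k * ?D (m - k) c)"
  proof -
    have "?D m (c + x a) = (\<Sum>S\<in>Pow A. (-1) ^ card S *
        (\<Sum>k\<le>m. (m choose k) * x a ^ k * (c + sum x S) ^ (m - k)))"
      by (intro sum.cong refl) (simp add: binomial_ring[symmetric] add_ac)
    also have "\<dots> = (\<Sum>k\<le>m. (m choose k) * x a ^ k * ?D (m - k) c)"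
      unfolding sum_distrib_left by (subst sum.swap) (simp add: mult_ac)
    finally show ?thesis .
  qed
  \<comment> \<open>The \<open>k = 0\<close> term will cancel against the first summand of the
    difference, which leaves only powers below \<open>m\<close>.\<close>
  also have "\<dots> = ?D m c + (\<Sum>k\<in>{1..m}. (m choose k) * x a ^ k * ?D (m - k) c)"
    by (subst atMost_atLeast0, subst sum.atLeast_Suc_atMost) auto
  also have "(\<Sum>k\<in>{1..m}. (m choose k) * x a ^ k * ?D (m - k) c) =
      (\<Sum>k\<in>{1..m}. if k = 1 then (if m = Suc (card A) then
         m * x a * ((-1) ^ card A * fact (card A) * prod x A) else 0) else 0)"
  proof (intro sum.cong refl)
    fix k assume k: "k \<in> {1..m}"
    with insert have le: "m - k \<le> card A" by auto
    \<comment> \<open>Among the lower powers only one of degree \<open>card A\<close> escapes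
      vanishing, and \<open>m \<le> card A + 1\<close> together with \<open>1 \<le> k\<close> then
      forces \<open>k = 1\<close>.\<close>
    have eq: "m - k = card A \<longleftrightarrow> k = 1 \<and> m = Suc (card A)"
      using k insert.prems insert.hyps by auto
    show "(m choose k) * x a ^ k * ?D (m - k) c =
      (if k = 1 then (if m = Suc (card A) then
         m * x a * ((-1) ^ card A * fact (card A) * prod x A) else 0) else 0)"
      unfolding insert.IH[OF le] eq by auto
  qed
  finally show ?case
    using insert.hyps by (auto simp: sum.delta)
qed

text \<open>\<open>v\<close> is the variance, and the coefficient is the double factorial
  \<open>(n - 1)!!\<close>. At \<open>v = 0\<close> the formula gives the moments of the constant 0,
  so degenerate variables are covered.\<close>

definition normal_moment :: "real \<Rightarrow> nat \<Rightarrow> real" where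
  "normal_moment v n =
     (if even n then fact n / (2 ^ (n div 2) * fact (n div 2)) * v ^ (n div 2) else 0)"

lemma normal_moment_2 [simp]: "normal_moment v 2 = v"
  by (simp add: normal_moment_def)

lemma normal_moment_4: "normal_moment v 4 = 3 * v\<^sup>2"
  by (simp add: normal_moment_def fact_numeral)

lemma normal_moment_zero: "normal_moment 0 n = 0 ^ n"
  by (auto simp: normal_moment_def power_0_left elim!: evenE)

text \<open>The moment form of the fact that variances of independent centered normal variables add.
  For \<open>n = 2 * m\<close> only even \<open>k = 2 * j\<close> contribute; there the factorials
  turn \<open>n choose 2 * j\<close> into \<open>m choose j\<close>, and the binomial theorem
  applies.\<close>

lemma normal_moment_add:
  "(\<Sum>k\<le>n. (n choose k) * (normal_moment v k * normal_moment w (n - k))) = normal_moment (v + w) n"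
proof (cases "even n")
  case False
  then have "normal_moment v k * normal_moment w (n - k) = 0" if "k \<le> n" for k
    using that by (auto simp: normal_moment_def)
  then show ?thesis
    using False by (simp add: normal_moment_def[of _ n] sum.neutral)
next
  case True
  then obtain m where m: "n = 2 * m" by (elim evenE)
  let ?f = "\<lambda>k. (n choose k) * (normal_moment v k * normal_moment w (n - k))"
  have "(\<Sum>k\<le>n. ?f k) = (\<Sum>k\<in>(\<lambda>j. 2 * j) ` {..m}. ?f k)"
  proof (rule sum.mono_neutral_right)
    show "\<forall>k\<in>{..n} - (\<lambda>j. 2 * j) ` {..m}. ?f k = 0"
      by (auto simp: normal_moment_def m elim!: evenE)
  qed (auto simp: m)
  also have "\<dots> = (\<Sum>j\<le>m. ?f (2 * j))"
    by (simp add: sum.reindex inj_on_def)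
  also have "\<dots> = (\<Sum>j\<le>m. fact n / (2 ^ m * fact m) * ((m choose j) * v ^ j * w ^ (m - j)))"
  proof (intro sum.cong refl)
    fix j assume j: "j \<in> {..m}"
    have e: "2 * m - 2 * j = 2 * (m - j)" by simp
    have p: "(2::real) ^ m = 2 ^ j * 2 ^ (m - j)"
      using j by (simp add: power_add[symmetric])
    show "?f (2 * j) = fact n / (2 ^ m * fact m) * ((m choose j) * v ^ j * w ^ (m - j))"
      using j by (simp add: m normal_moment_def binomial_fact e p)
  qed
  also have "\<dots> = normal_moment (v + w) n"
    unfolding sum_distrib_left[symmetric] by (simp add: binomial_ring normal_moment_def m)
  finally show ?thesis .
qed

text \<open>Independence enters only as factorisation of all products of powers, which is available
  both on a product space and for independent processes.\<close>

lemma has_bochner_integral_add_power: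
  fixes X Y :: "'a \<Rightarrow> real"
  assumes "\<And>k l. has_bochner_integral M (\<lambda>\<omega>. X \<omega> ^ k * Y \<omega> ^ l) (normal_moment v k * normal_moment w l)"
  shows "has_bochner_integral M (\<lambda>\<omega>. (X \<omega> + Y \<omega>) ^ n) (normal_moment (v + w) n)"
proof -
  have "has_bochner_integral M (\<lambda>\<omega>. \<Sum>k\<le>n. (n choose k) * (X \<omega> ^ k * Y \<omega> ^ (n - k)))
     (\<Sum>k\<le>n. (n choose k) * (normal_moment v k * normal_moment w (n - k)))"
    by (intro has_bochner_integral_sum has_bochner_integral_mult_right assms)
  then show ?thesis
    by (simp add: normal_moment_add binomial_ring mult.assoc)
qed

lemma has_bochner_integral_pair_mult:
  fixes f :: "'a \<Rightarrow> real" and g :: "'b \<Rightarrow> real"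
  assumes "prob_space M" "prob_space N"
  assumes f: "has_bochner_integral M f a" and g: "has_bochner_integral N g b"
  shows "has_bochner_integral (M \<Otimes>\<^sub>M N) (\<lambda>p. f (fst p) * g (snd p)) (a * b)"
proof -
  interpret M: prob_space M by fact
  interpret N: prob_space N by fact
  interpret P: pair_prob_space M N ..
  have fi: "integrable M f" "integral\<^sup>L M f = a" and gi: "integrable N g" "integral\<^sup>L N g = b"
    using f g by (auto simp: has_bochner_integral_iff)
  note [measurable] = borel_measurable_integrable[OF fi(1)] borel_measurable_integrable[OF gi(1)]
  have int: "integrable (M \<Otimes>\<^sub>M N) (\<lambda>p. f (fst p) * g (snd p))"
  proof (rule P.Fubini_integrable)
    show "integrable M (\<lambda>x. \<integral>y. norm (f (fst (x, y)) * g (snd (x, y))) \<partial>N)"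
      using fi gi by (simp add: abs_mult)
  qed (use gi in auto)
  moreover have "integral\<^sup>L (M \<Otimes>\<^sub>M N) (\<lambda>p. f (fst p) * g (snd p)) = a * b"
    using P.integral_fst'[OF int] fi gi by simp
  ultimately show ?thesis by (simp add: has_bochner_integral_iff)
qed

lemma distributed_normal_moment:
  assumes s: "0 < s" and D: "distributed M lborel X (\<lambda>x. ennreal (normal_density 0 s x))"
  shows "has_bochner_integral M (\<lambda>\<omega>. X \<omega> ^ n) (normal_moment (s\<^sup>2) n)"
proof -
  have "has_bochner_integral lborel (\<lambda>x. normal_density 0 s x * x ^ n) (normal_moment (s\<^sup>2) n)"
  proof (cases "even n")
    case True
    then show ?thesis
      using normal_moment_even[OF s, of 0 "n div 2"]
      by (simp add: normal_moment_def power_divide field_simps)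
  next
    case False
    then show ?thesis
      using normal_moment_odd[OF s, of 0 "n div 2"] by (simp add: normal_moment_def)
  qed
  then show ?thesis
    using distributed_integrable[OF D, of "\<lambda>x. x ^ n"] distributed_integral[OF D, of "\<lambda>x. x ^ n"]
    by (simp add: has_bochner_integral_iff)
qed

subsection \<open>Gaussian spaces\<close>

text \<open>Normality is recorded through moments, since everything evaluated later is a polynomial
  in the variables. The variance parameter is the second moment of the variable itself, and
  \<open>n = 1\<close> gives centering.\<close>

locale gaussian_space = prob_space M for M :: "'a measure" +
  fixes G :: "('a \<Rightarrow> real) set"
  assumes zero: "(\<lambda>_. 0) \<in> G"
    and add: "X \<in> G \<Longrightarrow> Y \<in> G \<Longrightarrow> (\<lambda>\<omega>. X \<omega> + Y \<omega>) \<in> G"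
    and scale: "X \<in> G \<Longrightarrow> (\<lambda>\<omega>. a * X \<omega>) \<in> G"
    and moment: "X \<in> G \<Longrightarrow>
      has_bochner_integral M (\<lambda>\<omega>. X \<omega> ^ n) (normal_moment (expectation (\<lambda>\<omega>. (X \<omega>)\<^sup>2)) n)"
begin

lemma sum_mem: "(\<And>i. i \<in> I \<Longrightarrow> X i \<in> G) \<Longrightarrow> (\<lambda>\<omega>. \<Sum>i\<in>I. X i \<omega>) \<in> G"
  by (induction I rule: infinite_finite_induct) (auto simp: zero add)

lemma diff_mem: "X \<in> G \<Longrightarrow> Y \<in> G \<Longrightarrow> (\<lambda>\<omega>. X \<omega> - Y \<omega>) \<in> G"
  using add[OF _ scale[of Y "-1"], of X] by simp

lemma integrable_power: "X \<in> G \<Longrightarrow> integrable M (\<lambda>\<omega>. X \<omega> ^ n)"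
  using moment by (auto simp: has_bochner_integral_iff)

lemma integrable_mult: "X \<in> G \<Longrightarrow> Y \<in> G \<Longrightarrow> integrable M (\<lambda>\<omega>. X \<omega> * Y \<omega>)"
proof -
  assume X: "X \<in> G" and Y: "Y \<in> G"
  have "integrable M (\<lambda>\<omega>. ((X \<omega> + Y \<omega>)\<^sup>2 - (X \<omega>)\<^sup>2 - (Y \<omega>)\<^sup>2) / 2)"
    using integrable_power[OF add[OF X Y]] integrable_power[OF X] integrable_power[OF Y] by simp
  then show ?thesis by (simp add: power2_sum mult.assoc)
qed

lemma second_moment_add:
  assumes X: "X \<in> G" and Y: "Y \<in> G"
  shows "expectation (\<lambda>\<omega>. (a * X \<omega> + b * Y \<omega>)\<^sup>2) =
    a\<^sup>2 * expectation (\<lambda>\<omega>. (X \<omega>)\<^sup>2) + b\<^sup>2 * expectation (\<lambda>\<omega>. (Y \<omega>)\<^sup>2)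
      + 2 * a * b * expectation (\<lambda>\<omega>. X \<omega> * Y \<omega>)"
proof -
  have "expectation (\<lambda>\<omega>. (a * X \<omega> + b * Y \<omega>)\<^sup>2) =
      expectation (\<lambda>\<omega>. a\<^sup>2 * (X \<omega>)\<^sup>2 + b\<^sup>2 * (Y \<omega>)\<^sup>2 + (2 * a * b) * (X \<omega> * Y \<omega>))"
    by (intro Bochner_Integration.integral_cong) (auto simp: power2_sum power_mult_distrib)
  then show ?thesis
    using integrable_power[OF X] integrable_power[OF Y] integrable_mult[OF X Y] by simp
qed

lemma second_moment_sum:
  assumes "\<And>i. i \<in> I \<Longrightarrow> X i \<in> G"
  shows "expectation (\<lambda>\<omega>. (\<Sum>i\<in>I. a i * X i \<omega>)\<^sup>2) =
    (\<Sum>i\<in>I. \<Sum>j\<in>I. a i * a j * expectation (\<lambda>\<omega>. X i \<omega> * X j \<omega>))"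
proof -
  have "expectation (\<lambda>\<omega>. (\<Sum>i\<in>I. a i * X i \<omega>)\<^sup>2) =
      expectation (\<lambda>\<omega>. \<Sum>i\<in>I. \<Sum>j\<in>I. a i * a j * (X i \<omega> * X j \<omega>))"
    by (intro Bochner_Integration.integral_cong) (auto simp: power2_eq_square sum_product mult_ac)
  also have "\<dots> = (\<Sum>i\<in>I. \<Sum>j\<in>I. a i * a j * expectation (\<lambda>\<omega>. X i \<omega> * X j \<omega>))"
    using integrable_mult assms by (simp add: Bochner_Integration.integral_sum)
  finally show ?thesis .
qed

section \<open>Moments on the product of two copies\<close>

abbreviation PP :: "('a \<times> 'a) measure" where "PP \<equiv> M \<Otimes>\<^sub>M M"

lemma pair_moment:
  assumes "X \<in> G" "Y \<in> G"
  shows "has_bochner_integral PP (\<lambda>p. (X (fst p) + Y (snd p)) ^ n)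
    (normal_moment (expectation (\<lambda>\<omega>. (X \<omega>)\<^sup>2) + expectation (\<lambda>\<omega>. (Y \<omega>)\<^sup>2)) n)"
  by (rule has_bochner_integral_add_power)
     (rule has_bochner_integral_pair_mult[OF _ _ moment moment]; intro assms prob_space_axioms)

text \<open>By \<open>polarization\<close> the product is a combination of powers of subset sums,
  each an element of \<open>G\<close> in the first coordinate plus one in the second. The explicit
  value shows that \<open>X\<close> and \<open>Y\<close> enter only through the second moments of
  their subset sums.\<close>

lemma pair_prod_moment:
  assumes A: "finite A" and X: "\<And>k. k \<in> A \<Longrightarrow> X k \<in> G" and Y: "\<And>k. k \<in> A \<Longrightarrow> Y k \<in> G"
  shows "has_bochner_integral PP (\<lambda>p. \<Prod>k\<in>A. X k (fst p) + Y k (snd p))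
    ((\<Sum>S\<in>Pow A. (-1) ^ card S *
       normal_moment (expectation (\<lambda>\<omega>. (\<Sum>k\<in>S. X k \<omega>)\<^sup>2) + expectation (\<lambda>\<omega>. (\<Sum>k\<in>S. Y k \<omega>)\<^sup>2)) (card A))
     / ((-1) ^ card A * fact (card A)))"
proof -
  let ?n = "card A"
  have "has_bochner_integral PP (\<lambda>p. (\<Sum>S\<in>Pow A. (-1) ^ card S *
      ((\<Sum>k\<in>S. X k (fst p)) + (\<Sum>k\<in>S. Y k (snd p))) ^ ?n) / ((-1) ^ ?n * fact ?n))
    ((\<Sum>S\<in>Pow A. (-1) ^ card S *
       normal_moment (expectation (\<lambda>\<omega>. (\<Sum>k\<in>S. X k \<omega>)\<^sup>2) + expectation (\<lambda>\<omega>. (\<Sum>k\<in>S. Y k \<omega>)\<^sup>2)) ?n)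
     / ((-1) ^ ?n * fact ?n))"
    using X Y by (intro has_bochner_integral_divide_zero has_bochner_integral_sum
        has_bochner_integral_mult_right pair_moment sum_mem) auto
  moreover have "(\<Sum>S\<in>Pow A. (-1) ^ card S *
      ((\<Sum>k\<in>S. X k (fst p)) + (\<Sum>k\<in>S. Y k (snd p))) ^ ?n) / ((-1) ^ ?n * fact ?n) =
      (\<Prod>k\<in>A. X k (fst p) + Y k (snd p))" for p
    using polarization[OF A order_refl, of 0 "\<lambda>k. X k (fst p) + Y k (snd p)"]
    by (simp add: sum.distrib)
  ultimately show ?thesis by simp
qed

text \<open>Only moments are compared, so invariance of the joint law itself is never needed.\<close>
lemma rotation_invariance:
  assumes A: "finite A" and X: "\<And>k. k \<in> A \<Longrightarrow> X k \<in> G" and Y: "\<And>k. k \<in> A \<Longrightarrow> Y k \<in> G"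
  shows "integral\<^sup>L PP (\<lambda>p. \<Prod>k\<in>A. (X k (fst p) - Y k (fst p)) / sqrt 2 + (X k (snd p) + Y k (snd p)) / sqrt 2)
       = integral\<^sup>L PP (\<lambda>p. \<Prod>k\<in>A. X k (fst p) + Y k (snd p))"
proof -
  let ?c = "1 / sqrt 2 :: real"
  have mem: "(\<lambda>\<omega>. (X k \<omega> - Y k \<omega>) / sqrt 2) \<in> G" "(\<lambda>\<omega>. (X k \<omega> + Y k \<omega>) / sqrt 2) \<in> G" if "k \<in> A" for k
    using scale[OF diff_mem[OF X[OF that] Y[OF that]], of ?c]
      scale[OF add[OF X[OF that] Y[OF that]], of ?c] by simp_all
  \<comment> \<open>The two cross terms have opposite signs and cancel, and each square is counted
    twice with weight 1/2.\<close>
  have eq: "expectation (\<lambda>\<omega>. (\<Sum>k\<in>S. (X k \<omega> - Y k \<omega>) / sqrt 2)\<^sup>2)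
      + expectation (\<lambda>\<omega>. (\<Sum>k\<in>S. (X k \<omega> + Y k \<omega>) / sqrt 2)\<^sup>2)
      = expectation (\<lambda>\<omega>. (\<Sum>k\<in>S. X k \<omega>)\<^sup>2) + expectation (\<lambda>\<omega>. (\<Sum>k\<in>S. Y k \<omega>)\<^sup>2)"
    if S: "S \<in> Pow A" for S
  proof -
    have "(\<lambda>\<omega>. \<Sum>k\<in>S. X k \<omega>) \<in> G" "(\<lambda>\<omega>. \<Sum>k\<in>S. Y k \<omega>) \<in> G"
      using S X Y by (auto intro!: sum_mem)
    from second_moment_add[OF this, of ?c ?c] second_moment_add[OF this, of ?c "- ?c"]
    show ?thesis
      by (simp add: sum_divide_distrib[symmetric] sum.distrib sum_subtractf add_divide_distrib
          diff_divide_distrib power_divide)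
  qed
  have "integral\<^sup>L PP (\<lambda>p. \<Prod>k\<in>A. (X k (fst p) - Y k (fst p)) / sqrt 2 + (X k (snd p) + Y k (snd p)) / sqrt 2)
    = (\<Sum>S\<in>Pow A. (-1) ^ card S *
       normal_moment (expectation (\<lambda>\<omega>. (\<Sum>k\<in>S. (X k \<omega> - Y k \<omega>) / sqrt 2)\<^sup>2)
         + expectation (\<lambda>\<omega>. (\<Sum>k\<in>S. (X k \<omega> + Y k \<omega>) / sqrt 2)\<^sup>2)) (card A))
     / ((-1) ^ card A * fact (card A))"
    by (intro has_bochner_integral_integral_eq pair_prod_moment A mem)
  also have "\<dots> = (\<Sum>S\<in>Pow A. (-1) ^ card S *
       normal_moment (expectation (\<lambda>\<omega>. (\<Sum>k\<in>S. X k \<omega>)\<^sup>2) + expectation (\<lambda>\<omega>. (\<Sum>k\<in>S. Y k \<omega>)\<^sup>2)) (card A))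
     / ((-1) ^ card A * fact (card A))"
    by (intro arg_cong2[where f = "(/)"] sum.cong refl) (simp only: eq)
  also have "\<dots> = integral\<^sup>L PP (\<lambda>p. \<Prod>k\<in>A. X k (fst p) + Y k (snd p))"
    by (intro has_bochner_integral_integral_eq[symmetric] pair_prod_moment A X Y)
  finally show ?thesis .
qed

end

section \<open>Product expansion, Jensen's inequality and quadratic forms\<close>

text \<open>Brings a power of a bilinear form into the product shape of
  \<open>pair_prod_moment\<close>: each of the \<open>n\<close> factors splits into two linear ones,
  and the Boolean in the index tells them apart.\<close>

lemma power_sum_mult:
  fixes u v :: "'i \<Rightarrow> real"
  assumes "finite I"
  shows "(\<Sum>i\<in>I. u i * v i) ^ n =
    (\<Sum>f\<in>{..<n} \<rightarrow>\<^sub>E I. \<Prod>k\<in>{..<n} \<times> UNIV. if snd k then u (f (fst k)) else v (f (fst k)))"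
proof -
  have "(\<Sum>i\<in>I. u i * v i) ^ n = (\<Prod>k<n. \<Sum>i\<in>I. u i * v i)"
    by simp
  also have "\<dots> = (\<Sum>f\<in>{..<n} \<rightarrow>\<^sub>E I. \<Prod>k<n. u (f k) * v (f k))"
    using assms by (intro prod_sum_PiE) auto
  also have "\<dots> = (\<Sum>f\<in>{..<n} \<rightarrow>\<^sub>E I. \<Prod>k\<in>{..<n} \<times> UNIV. if snd k then u (f (fst k)) else v (f (fst k)))"
    unfolding prod.cartesian_product' by (simp add: UNIV_bool mult.commute)
  finally show ?thesis .
qed

text \<open>\<open>expectation Q\<close> is the mean of an independent copy of \<open>Q\<close>, so
  Jensen's inequality in the copy, with the original held fixed, replaces centering by a difference
  of two copies.\<close>

lemma (in prob_space) fourth_moment_diff_mean_le: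
  fixes Q :: "'a \<Rightarrow> real"
  assumes Q: "integrable M Q" and Q4: "integrable (M \<Otimes>\<^sub>M M) (\<lambda>p. (Q (snd p) - Q (fst p)) ^ 4)"
  shows "integrable M (\<lambda>\<omega>. (Q \<omega> - expectation Q) ^ 4)"
    and "expectation (\<lambda>\<omega>. (Q \<omega> - expectation Q) ^ 4)
      \<le> integral\<^sup>L (M \<Otimes>\<^sub>M M) (\<lambda>p. (Q (snd p) - Q (fst p)) ^ 4)"
proof -
  interpret P: pair_prob_space M M ..
  let ?F = "\<lambda>\<omega>. expectation (\<lambda>\<omega>'. (Q \<omega>' - Q \<omega>) ^ 4)"
  note [measurable] = borel_measurable_integrable[OF Q]
  have F: "integrable M ?F"
    using P.integrable_fst'[OF Q4] by simp
  have jensen: "AE \<omega> in M. (Q \<omega> - expectation Q) ^ 4 \<le> ?F \<omega>"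
    using P.AE_integrable_fst'[OF Q4]
  proof eventually_elim
    case (elim \<omega>)
    then have i4: "integrable M (\<lambda>\<omega>'. (Q \<omega>' - Q \<omega>) ^ 4)" by simp
    have eq: "((Q \<omega>' - Q \<omega>)\<^sup>2)\<^sup>2 = (Q \<omega>' - Q \<omega>) ^ 4" for \<omega>' by simp
    have i2: "integrable M (\<lambda>\<omega>'. (Q \<omega>' - Q \<omega>)\<^sup>2)"
      by (rule square_integrable_imp_integrable) (use i4 in \<open>auto simp: eq\<close>)
    have i1: "integrable M (\<lambda>\<omega>'. Q \<omega>' - Q \<omega>)" using Q by simp
    \<comment> \<open>Jensen's inequality for the fourth power is nonnegativity of the variance used
      twice, first for \<open>Q \<omega>' - Q \<omega>\<close> and then for its square.\<close>
    have "(expectation (\<lambda>\<omega>'. Q \<omega>' - Q \<omega>))\<^sup>2 \<le> expectation (\<lambda>\<omega>'. (Q \<omega>' - Q \<omega>)\<^sup>2)"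
      using variance_eq[OF i1 i2] variance_positive[of "\<lambda>\<omega>'. Q \<omega>' - Q \<omega>"] by simp
    then have "((expectation (\<lambda>\<omega>'. Q \<omega>' - Q \<omega>))\<^sup>2)\<^sup>2 \<le> (expectation (\<lambda>\<omega>'. (Q \<omega>' - Q \<omega>)\<^sup>2))\<^sup>2"
      by (intro power_mono) auto
    also have "\<dots> \<le> expectation (\<lambda>\<omega>'. ((Q \<omega>' - Q \<omega>)\<^sup>2)\<^sup>2)"
      using variance_eq[OF i2] variance_positive[of "\<lambda>\<omega>'. (Q \<omega>' - Q \<omega>)\<^sup>2"] i4 by (simp add: eq)
    also have "((expectation (\<lambda>\<omega>'. Q \<omega>' - Q \<omega>))\<^sup>2)\<^sup>2 = (Q \<omega> - expectation Q) ^ 4"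
      using Q by (simp add: prob_space power_minus_even power_mult[symmetric] power4_eq_xxxx algebra_simps)
    finally show ?case by (simp add: eq)
  qed
  show int: "integrable M (\<lambda>\<omega>. (Q \<omega> - expectation Q) ^ 4)"
    using jensen by (intro Bochner_Integration.integrable_bound[OF F]) (auto intro: order_trans)
  have "expectation (\<lambda>\<omega>. (Q \<omega> - expectation Q) ^ 4) \<le> expectation ?F"
    by (intro integral_mono_AE int F jensen)
  also have "expectation ?F = integral\<^sup>L (M \<Otimes>\<^sub>M M) (\<lambda>p. (Q (snd p) - Q (fst p)) ^ 4)"
    using P.integral_fst'[OF Q4] by simp
  finally show "expectation (\<lambda>\<omega>. (Q \<omega> - expectation Q) ^ 4)
      \<le> integral\<^sup>L (M \<Otimes>\<^sub>M M) (\<lambda>p. (Q (snd p) - Q (fst p)) ^ 4)" .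
qed

text \<open>This is the Schur test: each \<open>\<bar>z i * z j\<bar>\<close> is bounded by half the
  sum of the squares, and symmetry of \<open>C\<close> makes the two resulting halves equal.\<close>

lemma quadratic_form_le:
  fixes C :: "'i \<Rightarrow> 'i \<Rightarrow> real"
  assumes sym: "\<And>i j. i \<in> I \<Longrightarrow> j \<in> I \<Longrightarrow> C i j = C j i"
    and row: "\<And>i. i \<in> I \<Longrightarrow> (\<Sum>j\<in>I. \<bar>C i j\<bar>) \<le> \<kappa>"
  shows "\<bar>\<Sum>i\<in>I. \<Sum>j\<in>I. z i * z j * C i j\<bar> \<le> \<kappa> * (\<Sum>i\<in>I. (z i)\<^sup>2)"
proof -
  let ?T = "\<Sum>i\<in>I. \<Sum>j\<in>I. (z i)\<^sup>2 * \<bar>C i j\<bar>"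
  have "\<bar>\<Sum>i\<in>I. \<Sum>j\<in>I. z i * z j * C i j\<bar> \<le> (\<Sum>i\<in>I. \<Sum>j\<in>I. \<bar>z i * z j * C i j\<bar>)"
    by (intro order_trans[OF sum_abs] sum_mono order_refl)
  also have "\<dots> \<le> (\<Sum>i\<in>I. \<Sum>j\<in>I. (z i)\<^sup>2 * \<bar>C i j\<bar> / 2 + (z j)\<^sup>2 * \<bar>C i j\<bar> / 2)"
  proof (intro sum_mono)
    fix i j
    have "2 * (\<bar>z i\<bar> * \<bar>z j\<bar>) \<le> (z i)\<^sup>2 + (z j)\<^sup>2"
      using sum_squares_bound[of "\<bar>z i\<bar>" "\<bar>z j\<bar>"] by (simp add: mult.assoc)
    from mult_right_mono[OF this, of "\<bar>C i j\<bar>"]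
    show "\<bar>z i * z j * C i j\<bar> \<le> (z i)\<^sup>2 * \<bar>C i j\<bar> / 2 + (z j)\<^sup>2 * \<bar>C i j\<bar> / 2"
      by (simp add: abs_mult field_simps)
  qed
  also have "\<dots> = ?T / 2 + (\<Sum>i\<in>I. \<Sum>j\<in>I. (z j)\<^sup>2 * \<bar>C i j\<bar>) / 2"
    by (simp add: sum.distrib sum_divide_distrib)
  also have "(\<Sum>i\<in>I. \<Sum>j\<in>I. (z j)\<^sup>2 * \<bar>C i j\<bar>) = ?T"
    by (subst sum.swap) (auto intro!: sum.cong simp: sym)
  also have "?T / 2 + ?T / 2 = (\<Sum>i\<in>I. (z i)\<^sup>2 * (\<Sum>j\<in>I. \<bar>C i j\<bar>))"
    by (simp add: sum_distrib_left)
  also have "\<dots> \<le> (\<Sum>i\<in>I. (z i)\<^sup>2 * \<kappa>)"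
    by (intro sum_mono mult_left_mono row) auto
  finally show ?thesis by (simp add: sum_distrib_left mult.commute)
qed

section \<open>Decoupling and the fourth moment of the sum of squares\<close>

context gaussian_space
begin

text \<open>For two copies \<open>Z\<close> and \<open>Z'\<close> the difference of squares is
  \<open>(Z' - Z) * (Z' + Z)\<close>, and these factors are \<open>sqrt 2\<close> times a rotated
  pair of copies. After expansion into products, \<open>rotation_invariance\<close> puts the
  original pair in place of the rotated one.\<close>

lemma decoupling:
  fixes Z :: "'i \<Rightarrow> 'a \<Rightarrow> real"
  assumes I: "finite I" and Z: "\<And>i. i \<in> I \<Longrightarrow> Z i \<in> G"
  shows "integrable PP (\<lambda>p. ((\<Sum>i\<in>I. (Z i (snd p))\<^sup>2) - (\<Sum>i\<in>I. (Z i (fst p))\<^sup>2)) ^ n)"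
    and "integrable PP (\<lambda>p. (\<Sum>i\<in>I. Z i (fst p) * Z i (snd p)) ^ n)"
    and "integral\<^sup>L PP (\<lambda>p. ((\<Sum>i\<in>I. (Z i (snd p))\<^sup>2) - (\<Sum>i\<in>I. (Z i (fst p))\<^sup>2)) ^ n)
       = 2 ^ n * integral\<^sup>L PP (\<lambda>p. (\<Sum>i\<in>I. Z i (fst p) * Z i (snd p)) ^ n)"
proof -
  let ?A = "{..<n} \<times> (UNIV :: bool set)" and ?F = "{..<n} \<rightarrow>\<^sub>E I"
  \<comment> \<open>The factor \<open>sqrt 2\<close> cancels the normalisation of the rotation: the
    factors of \<open>U\<close> are then \<open>Z\<close> at \<open>snd p\<close> minus or plus
    \<open>Z\<close> at \<open>fst p\<close>, while each pair of factors of \<open>V\<close> carries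
    \<open>sqrt 2 * sqrt 2 = 2\<close>, the source of \<open>2 ^ n\<close>.\<close>
  define X where "X f k \<omega> = (if snd k then 0 else sqrt 2 * Z (f (fst k)) \<omega>)" for f :: "nat \<Rightarrow> 'i" and k :: "nat \<times> bool" and \<omega>
  define Y where "Y f k \<omega> = (if snd k then sqrt 2 * Z (f (fst k)) \<omega> else 0)" for f :: "nat \<Rightarrow> 'i" and k :: "nat \<times> bool" and \<omega>
  have mem: "X f k \<in> G" "Y f k \<in> G" if "f \<in> ?F" "k \<in> ?A" for f k
  proof -
    have "Z (f (fst k)) \<in> G" using that Z by (auto simp: PiE_iff)
    from scale[OF this] show "X f k \<in> G" "Y f k \<in> G"
      by (cases "snd k"; simp add: X_def[abs_def] Y_def[abs_def] zero)+
  qed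
  define U where "U f p = (\<Prod>k\<in>?A. (X f k (fst p) - Y f k (fst p)) / sqrt 2 + (X f k (snd p) + Y f k (snd p)) / sqrt 2)" for f p
  define V where "V f p = (\<Prod>k\<in>?A. X f k (fst p) + Y f k (snd p))" for f p
  have U: "((\<Sum>i\<in>I. (Z i (snd p))\<^sup>2) - (\<Sum>i\<in>I. (Z i (fst p))\<^sup>2)) ^ n = (\<Sum>f\<in>?F. U f p)" for p
  proof -
    have "((\<Sum>i\<in>I. (Z i (snd p))\<^sup>2) - (\<Sum>i\<in>I. (Z i (fst p))\<^sup>2)) ^ n =
        (\<Sum>i\<in>I. (- Z i (fst p) + Z i (snd p)) * (Z i (fst p) + Z i (snd p))) ^ n"
      by (simp add: sum_subtractf[symmetric] power2_eq_square algebra_simps)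
    also have "\<dots> = (\<Sum>f\<in>?F. U f p)"
      unfolding power_sum_mult[OF I] U_def
      by (intro sum.cong prod.cong refl) (auto simp: X_def Y_def)
    finally show ?thesis .
  qed
  have V: "(\<Sum>i\<in>I. Z i (fst p) * Z i (snd p)) ^ n = (\<Sum>f\<in>?F. V f p) / 2 ^ n" for p
  proof -
    have "2 ^ n * (\<Sum>i\<in>I. Z i (fst p) * Z i (snd p)) ^ n =
        (\<Sum>i\<in>I. (sqrt 2 * Z i (snd p)) * (sqrt 2 * Z i (fst p))) ^ n"
    proof -
      have "(sqrt 2 * Z i (snd p)) * (sqrt 2 * Z i (fst p)) = 2 * (Z i (fst p) * Z i (snd p))" for i
        by (simp add: mult.assoc[symmetric])
      then show ?thesis
        by (simp only: power_mult_distrib[symmetric] sum_distrib_left)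
    qed
    also have "\<dots> = (\<Sum>f\<in>?F. V f p)"
      unfolding power_sum_mult[OF I] V_def
      by (intro sum.cong prod.cong refl) (auto simp: X_def Y_def)
    finally show ?thesis by (simp add: field_simps)
  qed
  have mem': "(\<lambda>\<omega>. (X f k \<omega> - Y f k \<omega>) / sqrt 2) \<in> G" "(\<lambda>\<omega>. (X f k \<omega> + Y f k \<omega>) / sqrt 2) \<in> G"
    if "f \<in> ?F" "k \<in> ?A" for f k
    using scale[OF diff_mem[OF mem[OF that]], of "1 / sqrt 2"]
      scale[OF add[OF mem[OF that]], of "1 / sqrt 2"] by simp_all
  have intV: "integrable PP (V f)" if "f \<in> ?F" for f
    unfolding V_def[abs_def] using pair_prod_moment[of ?A "X f" "Y f"] mem[OF that]
    by (auto simp: has_bochner_integral_iff)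
  have intU: "integrable PP (U f)" if "f \<in> ?F" for f
    unfolding U_def[abs_def]
    by (rule integrable.intros, rule pair_prod_moment) (use mem'[OF that] in auto)
  have UV: "integral\<^sup>L PP (U f) = integral\<^sup>L PP (V f)" if "f \<in> ?F" for f
    unfolding U_def[abs_def] V_def[abs_def]
    by (rule rotation_invariance) (use mem[OF that] in auto)
  show "integrable PP (\<lambda>p. ((\<Sum>i\<in>I. (Z i (snd p))\<^sup>2) - (\<Sum>i\<in>I. (Z i (fst p))\<^sup>2)) ^ n)"
    unfolding U by (intro Bochner_Integration.integrable_sum intU)
  show "integrable PP (\<lambda>p. (\<Sum>i\<in>I. Z i (fst p) * Z i (snd p)) ^ n)"
    unfolding V by (intro integrable_divide_zero Bochner_Integration.integrable_sum intV)
  show "integral\<^sup>L PP (\<lambda>p. ((\<Sum>i\<in>I. (Z i (snd p))\<^sup>2) - (\<Sum>i\<in>I. (Z i (fst p))\<^sup>2)) ^ n)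
       = 2 ^ n * integral\<^sup>L PP (\<lambda>p. (\<Sum>i\<in>I. Z i (fst p) * Z i (snd p)) ^ n)"
    unfolding U V using intU intV UV by (simp add: Bochner_Integration.integral_sum)
qed

text \<open>With the first copy fixed, the bilinear form is a Gaussian variable whose variance is a
  quadratic form controlled by \<open>\<kappa>\<close>. The constant is
  \<open>144 = 2 ^ 4 * 3 * 3\<close>: decoupling, the fourth moment of that variable, and the fourth
  moments of the \<open>Z i\<close>.\<close>

lemma quadratic_variation_fourth_moment:
  fixes Z :: "'i \<Rightarrow> 'a \<Rightarrow> real" and c \<kappa> :: real
  assumes I: "finite I" and Z: "\<And>i. i \<in> I \<Longrightarrow> Z i \<in> G"
    and c: "\<And>i. i \<in> I \<Longrightarrow> expectation (\<lambda>\<omega>. (Z i \<omega>)\<^sup>2) = c"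
    and row: "\<And>i. i \<in> I \<Longrightarrow> (\<Sum>j\<in>I. \<bar>expectation (\<lambda>\<omega>. Z i \<omega> * Z j \<omega>)\<bar>) \<le> \<kappa>"
  shows "integrable M (\<lambda>\<omega>. ((\<Sum>i\<in>I. (Z i \<omega>)\<^sup>2) - card I * c) ^ 4)"
    and "expectation (\<lambda>\<omega>. ((\<Sum>i\<in>I. (Z i \<omega>)\<^sup>2) - card I * c) ^ 4) \<le> 144 * \<kappa>\<^sup>2 * (card I * c)\<^sup>2"
proof -
  interpret P: pair_prob_space M M ..
  let ?Q = "\<lambda>\<omega>. \<Sum>i\<in>I. (Z i \<omega>)\<^sup>2"
  let ?C = "\<lambda>i j. expectation (\<lambda>\<omega>. Z i \<omega> * Z j \<omega>)"
  let ?D = "\<lambda>p. (\<Sum>i\<in>I. Z i (fst p) * Z i (snd p)) ^ 4"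
  have intQ: "integrable M ?Q"
    by (intro Bochner_Integration.integrable_sum integrable_power Z)
  have EQ: "expectation ?Q = card I * c"
    using Z by (simp add: Bochner_Integration.integral_sum integrable_power c)
  note dec = decoupling[where n = 4, OF I Z, simplified]
  have Q4: "integrable M (\<lambda>\<omega>. (Z i \<omega>) ^ 4)" "expectation (\<lambda>\<omega>. (Z i \<omega>) ^ 4) = 3 * c\<^sup>2" if "i \<in> I" for i
    using moment[OF Z[OF that], of 4] c[OF that] by (auto simp: has_bochner_integral_iff normal_moment_4)
  have inner: "expectation (\<lambda>\<omega>'. ?D (\<omega>, \<omega>')) \<le> 3 * \<kappa>\<^sup>2 * (card I * (\<Sum>i\<in>I. (Z i \<omega>) ^ 4))" for \<omega>
  proof -
    let ?v = "\<Sum>i\<in>I. \<Sum>j\<in>I. Z i \<omega> * Z j \<omega> * ?C i j"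
    have "(\<lambda>\<omega>'. \<Sum>i\<in>I. Z i \<omega> * Z i \<omega>') \<in> G"
      by (intro sum_mem scale Z)
    from moment[OF this, of 4] have "expectation (\<lambda>\<omega>'. ?D (\<omega>, \<omega>')) = 3 * ?v\<^sup>2"
      using Z by (simp add: has_bochner_integral_iff normal_moment_4 second_moment_sum)
    also have "?v\<^sup>2 \<le> (\<kappa> * ?Q \<omega>)\<^sup>2"
      using quadratic_form_le[of I ?C \<kappa> "\<lambda>i. Z i \<omega>"] row
      by (intro abs_le_square_iff[THEN iffD1]) (force simp: mult.commute)
    \<comment> \<open>Cauchy-Schwarz against the constant 1 leaves single fourth powers, so no mixed
      moments of different \<open>Z i\<close> have to be computed.\<close>
    also have "(?Q \<omega>)\<^sup>2 \<le> card I * (\<Sum>i\<in>I. ((Z i \<omega>)\<^sup>2)\<^sup>2)"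
      using sum_squared_le_sum_of_squares[of "\<lambda>i. (Z i \<omega>)\<^sup>2" I] I by (simp add: mult.commute)
    then have "(\<kappa> * ?Q \<omega>)\<^sup>2 \<le> \<kappa>\<^sup>2 * (card I * (\<Sum>i\<in>I. (Z i \<omega>) ^ 4))"
      by (simp add: power_mult_distrib mult_left_mono)
    finally show ?thesis by simp
  qed
  have "integral\<^sup>L PP ?D = expectation (\<lambda>\<omega>. expectation (\<lambda>\<omega>'. ?D (\<omega>, \<omega>')))"
    using P.integral_fst'[OF dec(2)] by simp
  also have "\<dots> \<le> expectation (\<lambda>\<omega>. 3 * \<kappa>\<^sup>2 * (card I * (\<Sum>i\<in>I. (Z i \<omega>) ^ 4)))"
    using Q4 P.integrable_fst'[OF dec(2)] inner by (intro integral_mono) auto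
  also have "\<dots> = 9 * \<kappa>\<^sup>2 * (card I * c)\<^sup>2"
    using Q4 by (simp add: Bochner_Integration.integral_sum power_mult_distrib power2_eq_square)
  finally have D: "integral\<^sup>L PP ?D \<le> 9 * \<kappa>\<^sup>2 * (card I * c)\<^sup>2" .
  show "integrable M (\<lambda>\<omega>. (?Q \<omega> - card I * c) ^ 4)"
    using fourth_moment_diff_mean_le(1)[OF intQ] dec(1) by (simp add: EQ)
  have "expectation (\<lambda>\<omega>. (?Q \<omega> - card I * c) ^ 4) \<le> 16 * integral\<^sup>L PP ?D"
    using fourth_moment_diff_mean_le(2)[OF intQ] dec(1,3) by (simp add: EQ)
  with D show "expectation (\<lambda>\<omega>. (?Q \<omega> - card I * c) ^ 4) \<le> 144 * \<kappa>\<^sup>2 * (card I * c)\<^sup>2"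
    by simp
qed

end

subsection \<open>Linear combinations of Gaussian processes\<close>

definition linear_combinations :: "'t set \<Rightarrow> ('t \<Rightarrow> 'a \<Rightarrow> real) \<Rightarrow> ('a \<Rightarrow> real) set" where
  "linear_combinations T X = {(\<lambda>\<omega>. \<Sum>t\<in>I. c t * X t \<omega>) | I c. finite I \<and> I \<subseteq> T}"

lemma linear_combinationsI:
  "finite I \<Longrightarrow> I \<subseteq> T \<Longrightarrow> (\<lambda>\<omega>. \<Sum>t\<in>I. c t * X t \<omega>) \<in> linear_combinations T X"
  by (auto simp: linear_combinations_def)

lemma linear_combinations_add:
  assumes "f \<in> linear_combinations T X" "g \<in> linear_combinations T X"
  shows "(\<lambda>\<omega>. f \<omega> + g \<omega>) \<in> linear_combinations T X"
proof -
  obtain I c where f: "f = (\<lambda>\<omega>. \<Sum>t\<in>I. c t * X t \<omega>)" "finite I" "I \<subseteq> T"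
    using assms(1) by (auto simp: linear_combinations_def)
  obtain J d where g: "g = (\<lambda>\<omega>. \<Sum>t\<in>J. d t * X t \<omega>)" "finite J" "J \<subseteq> T"
    using assms(2) by (auto simp: linear_combinations_def)
  have ext: "(\<Sum>t\<in>K. e t * X t \<omega>) = (\<Sum>t\<in>I \<union> J. (if t \<in> K then e t else 0) * X t \<omega>)"
    if "K \<subseteq> I \<union> J" for K e \<omega>
    using that f(2) g(2) by (intro sum.mono_neutral_cong_left) auto
  have eq: "(\<lambda>\<omega>. f \<omega> + g \<omega>) =
      (\<lambda>\<omega>. \<Sum>t\<in>I \<union> J. ((if t \<in> I then c t else 0) + (if t \<in> J then d t else 0)) * X t \<omega>)"
    unfolding f(1) g(1) distrib_right sum.distrib ext[OF Un_upper1] ext[OF Un_upper2] ..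
  show ?thesis
    unfolding eq using f g by (intro linear_combinationsI) auto
qed

lemma linear_combinations_scale:
  assumes "f \<in> linear_combinations T X"
  shows "(\<lambda>\<omega>. a * f \<omega>) \<in> linear_combinations T X"
proof -
  obtain I c where f: "f = (\<lambda>\<omega>. \<Sum>t\<in>I. c t * X t \<omega>)" "finite I" "I \<subseteq> T"
    using assms(1) by (auto simp: linear_combinations_def)
  have eq: "(\<lambda>\<omega>. a * f \<omega>) = (\<lambda>\<omega>. \<Sum>t\<in>I. (a * c t) * X t \<omega>)"
    by (simp add: f(1) sum_distrib_left mult.assoc)
  show ?thesis
    unfolding eq using f(2,3) by (rule linear_combinationsI)
qed

lemma linear_combinations_zero: "(\<lambda>_. 0) \<in> linear_combinations T X"
  unfolding linear_combinations_def by (intro CollectI exI[of _ "{}"]) auto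

lemma linear_combinations_base: "t \<in> T \<Longrightarrow> X t \<in> linear_combinations T X"
  unfolding linear_combinations_def by (intro CollectI exI[of _ "{t}"] exI[of _ "\<lambda>_. 1"]) auto

text \<open>The absolute value accounts for the junk case \<open>v < 0\<close> of the definition, where
  \<open>sqrt v\<close> is negative but \<^const>\<open>normal_density\<close> only depends on its square.\<close>
lemma centered_gaussian_process_moment:
  assumes "prob_space M" "centered_gaussian_process M T X K" "finite I" "I \<subseteq> T"
  shows "has_bochner_integral M (\<lambda>\<omega>. (\<Sum>t\<in>I. c t * X t \<omega>) ^ n)
    (normal_moment \<bar>\<Sum>s\<in>I. \<Sum>t\<in>I. c s * c t * K s t\<bar> n)"
proof -
  interpret prob_space M by fact
  let ?v = "\<Sum>s\<in>I. \<Sum>t\<in>I. c s * c t * K s t" and ?L = "\<lambda>\<omega>. \<Sum>t\<in>I. c t * X t \<omega>"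
  have meas [measurable]: "?L \<in> borel_measurable M"
    using assms by (intro borel_measurable_sum borel_measurable_times)
      (auto simp: centered_gaussian_process_def)
  have law: "if ?v = 0 then (AE \<omega> in M. ?L \<omega> = 0)
      else distributed M lborel ?L (\<lambda>x. ennreal (normal_density 0 (sqrt ?v) x))"
    using assms(2-4) unfolding centered_gaussian_process_def Let_def by blast
  show ?thesis
  proof (cases "?v = 0")
    case True
    have "has_bochner_integral M (\<lambda>\<omega>. 0 ^ n) (0 ^ n :: real)"
      by (simp add: has_bochner_integral_iff prob_space)
    moreover have "AE \<omega> in M. ?L \<omega> ^ n = 0 ^ n"
      using law True by auto
    ultimately have "has_bochner_integral M (\<lambda>\<omega>. ?L \<omega> ^ n) (0 ^ n)"
      by (subst has_bochner_integral_cong_AE) auto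
    then show ?thesis by (simp add: True normal_moment_zero)
  next
    case False
    have "normal_density 0 (sqrt ?v) = normal_density 0 (sqrt \<bar>?v\<bar>)"
      by (cases "0 \<le> ?v") (auto simp: normal_density_def fun_eq_iff real_sqrt_minus)
    then have "distributed M lborel ?L (\<lambda>x. ennreal (normal_density 0 (sqrt \<bar>?v\<bar>) x))"
      using law False by simp
    from distributed_normal_moment[OF _ this] False show ?thesis by simp
  qed
qed

text \<open>Independence of the path maps passes to powers of finite linear combinations, which are
  measurable functions of the path. The absolute values are inherited from
  \<open>centered_gaussian_process_moment\<close>.\<close>

lemma indep_process_sum_moment:
  assumes "prob_space M"
    and X: "centered_gaussian_process M {0..} X K" and Y: "centered_gaussian_process M {0..} Y K'"
    and ind: "prob_space.indep_var M (PiM {0..} (\<lambda>_. borel)) (path X) (PiM {0..} (\<lambda>_. borel)) (path Y)"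
    and I: "finite I" "I \<subseteq> {0..}"
  shows "has_bochner_integral M (\<lambda>\<omega>. (\<Sum>t\<in>I. c t * (X t \<omega> + Y t \<omega>)) ^ n)
    (normal_moment (\<bar>\<Sum>s\<in>I. \<Sum>t\<in>I. c s * c t * K s t\<bar> + \<bar>\<Sum>s\<in>I. \<Sum>t\<in>I. c s * c t * K' s t\<bar>) n)"
proof -
  interpret prob_space M by fact
  let ?p = "\<lambda>k f. (\<Sum>t\<in>I. c t * f t) ^ k :: real"
  \<comment> \<open>\<open>I\<close> lies in \<open>{0..}\<close>, so the restriction in
    \<open>path\<close> does not affect the coordinates read here.\<close>
  have comp: "?p k \<circ> path Z = (\<lambda>\<omega>. (\<Sum>t\<in>I. c t * Z t \<omega>) ^ k)" for k and Z :: "real \<Rightarrow> 'a \<Rightarrow> real"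
    using I by (auto simp: path_def fun_eq_iff subset_iff intro!: arg_cong[where f = "\<lambda>x. x ^ k"] sum.cong)
  have meas: "?p k \<in> borel_measurable (PiM {0..} (\<lambda>_. borel))" for k
    using I by (intro borel_measurable_power borel_measurable_sum borel_measurable_times) auto
  have "has_bochner_integral M (\<lambda>\<omega>. (\<Sum>t\<in>I. c t * X t \<omega>) ^ k * (\<Sum>t\<in>I. c t * Y t \<omega>) ^ l)
     (normal_moment \<bar>\<Sum>s\<in>I. \<Sum>t\<in>I. c s * c t * K s t\<bar> k * normal_moment \<bar>\<Sum>s\<in>I. \<Sum>t\<in>I. c s * c t * K' s t\<bar> l)" for k l
  proof -
    have "indep_var borel (\<lambda>\<omega>. (\<Sum>t\<in>I. c t * X t \<omega>) ^ k) borel (\<lambda>\<omega>. (\<Sum>t\<in>I. c t * Y t \<omega>) ^ l)"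
      using indep_var_compose[OF ind meas[of k] meas[of l]] unfolding comp .
    then show ?thesis
      using centered_gaussian_process_moment[OF assms(1) X I, of c k]
        centered_gaussian_process_moment[OF assms(1) Y I, of c l]
      by (auto simp: has_bochner_integral_iff indep_var_lebesgue_integral indep_var_integrable)
  qed
  from has_bochner_integral_add_power[OF this] show ?thesis
    by (simp add: distrib_left sum.distrib)
qed

lemma gaussian_space_indep_process_sum:
  assumes "prob_space M"
    and "centered_gaussian_process M {0..} X K" and "centered_gaussian_process M {0..} Y K'"
    and "prob_space.indep_var M (PiM {0..} (\<lambda>_. borel)) (path X) (PiM {0..} (\<lambda>_. borel)) (path Y)"
  shows "gaussian_space M (linear_combinations {0..} (\<lambda>t \<omega>. X t \<omega> + Y t \<omega>))"
proof -
  interpret prob_space M by fact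
  show ?thesis
  proof (unfold_locales, goal_cases)
    case (4 f n)
    then obtain I c where f: "f = (\<lambda>\<omega>. \<Sum>t\<in>I. c t * (X t \<omega> + Y t \<omega>))" "finite I" "I \<subseteq> {0..}"
      by (auto simp: linear_combinations_def)
    note mom = indep_process_sum_moment[OF assms f(2,3), of c]
    show ?case
      \<comment> \<open>Exponent 2 identifies the variance parameter with the second moment of the
        variable, as the locale demands.\<close>
      using mom[of n] mom[of 2] by (simp add: f(1) has_bochner_integral_iff)
  qed (intro linear_combinations_zero linear_combinations_add linear_combinations_scale; assumption)+
qed

text \<open>The covariance is recovered from the second moments at \<open>s\<close>, at
  \<open>t\<close> and of the sum of the two values. The sign conditions on \<open>K\<close> and
  \<open>K'\<close> remove the absolute values from these variances.\<close>

lemma indep_process_sum_covariance: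
  assumes "prob_space M"
    and "centered_gaussian_process M {0..} X K" and "centered_gaussian_process M {0..} Y K'"
    and "prob_space.indep_var M (PiM {0..} (\<lambda>_. borel)) (path X) (PiM {0..} (\<lambda>_. borel)) (path Y)"
    and st: "0 \<le> s" "0 \<le> t"
    and K: "\<And>u v. K u v = K v u" "\<And>u. 0 \<le> u \<Longrightarrow> 0 \<le> K u u" "0 \<le> K s s + K t t + 2 * K s t"
    and K': "\<And>u v. K' u v = K' v u" "\<And>u. 0 \<le> u \<Longrightarrow> 0 \<le> K' u u" "0 \<le> K' s s + K' t t + 2 * K' s t"
  shows "integral\<^sup>L M (\<lambda>\<omega>. (X s \<omega> + Y s \<omega>) * (X t \<omega> + Y t \<omega>)) = K s t + K' s t"
proof -
  let ?Z = "\<lambda>t \<omega>. X t \<omega> + Y t \<omega>"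
  interpret gaussian_space M "linear_combinations {0..} ?Z"
    by (rule gaussian_space_indep_process_sum) fact+
  note mom = indep_process_sum_moment[OF assms(1-4), where n = 2]
  have sq: "expectation (\<lambda>\<omega>. (?Z u \<omega>)\<^sup>2) = K u u + K' u u" if "0 \<le> u" for u
    using mom[of "{u}" "\<lambda>_. 1"] that K(2)[OF that] K'(2)[OF that] by (simp add: has_bochner_integral_iff)
  show ?thesis
  \<comment> \<open>For \<open>s = t\<close> the index set \<open>{s, t}\<close> collapses to a
    singleton, and the two-point computation does not apply.\<close>
  proof (cases "s = t")
    case True
    then show ?thesis using sq[OF st(1)] by (simp add: power2_eq_square)
  next
    case False
    have "expectation (\<lambda>\<omega>. (?Z s \<omega> + ?Z t \<omega>)\<^sup>2) = (K s s + K t t + 2 * K s t) + (K' s s + K' t t + 2 * K' s t)"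
      using mom[of "{s, t}" "\<lambda>_. 1"] st False K(3) K'(3) K(1)[of t s] K'(1)[of t s]
      by (simp add: has_bochner_integral_iff algebra_simps)
    moreover have "?Z s \<in> linear_combinations {0..} ?Z" "?Z t \<in> linear_combinations {0..} ?Z"
      using st linear_combinations_base[of _ "{0..}" ?Z] by auto
    from second_moment_add[OF this, of 1 1]
    have "expectation (\<lambda>\<omega>. (?Z s \<omega> + ?Z t \<omega>)\<^sup>2) = expectation (\<lambda>\<omega>. (?Z s \<omega>)\<^sup>2)
        + expectation (\<lambda>\<omega>. (?Z t \<omega>)\<^sup>2) + 2 * expectation (\<lambda>\<omega>. ?Z s \<omega> * ?Z t \<omega>)" by simp
    ultimately show ?thesis using sq st by simp
  qed
qed

subsection \<open>Covariance of fractional Gaussian noise\<close>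

lemma powr_increment_has_derivative:
  "0 < x \<Longrightarrow> ((\<lambda>x::real. (x + 1) powr p - x powr p) has_real_derivative
     p * (x + 1) powr (p - 1) - p * x powr (p - 1)) (at x)"
  by (auto intro!: derivative_eq_intros)

lemma continuous_on_powr_increment:
  "0 < p \<Longrightarrow> continuous_on {0..} (\<lambda>x::real. (x + 1) powr p - x powr p)"
  by (intro continuous_intros continuous_on_powr') auto

lemma powr_increment_mono:
  fixes x y p :: real
  assumes "0 \<le> x" "x \<le> y" "1 \<le> p"
  shows "(x + 1) powr p - x powr p \<le> (y + 1) powr p - y powr p"
\<comment> \<open>The derivative formula is available for positive arguments and \<open>x\<close>
  may be 0, hence the test with derivatives in the open interval and continuity at its ends.\<close>
proof (rule DERIV_nonneg_imp_increasing_open[OF assms(2)])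
  fix z assume "x < z" "z < y"
  then show "\<exists>d. ((\<lambda>x. (x + 1) powr p - x powr p) has_real_derivative d) (at z) \<and> 0 \<le> d"
    using assms
    by (intro exI[of _ "p * (z + 1) powr (p - 1) - p * z powr (p - 1)"] conjI
        powr_increment_has_derivative) (auto intro!: mult_left_mono powr_mono2)
qed (use assms continuous_on_powr_increment[of p] in \<open>auto elim!: continuous_on_subset\<close>)

lemma powr_increment_antimono:
  fixes x y p :: real
  assumes "0 \<le> x" "x \<le> y" "0 < p" "p \<le> 1"
  shows "(y + 1) powr p - y powr p \<le> (x + 1) powr p - x powr p"
proof (rule DERIV_nonpos_imp_decreasing_open[OF assms(2)])
  fix z assume "x < z" "z < y"
  then show "\<exists>d. ((\<lambda>x. (x + 1) powr p - x powr p) has_real_derivative d) (at z) \<and> d \<le> 0"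
    using assms
    by (intro exI[of _ "p * (z + 1) powr (p - 1) - p * z powr (p - 1)"] conjI
        powr_increment_has_derivative) (auto intro!: mult_left_mono powr_mono2')
qed (use assms continuous_on_powr_increment[of p] in \<open>auto elim!: continuous_on_subset\<close>)

text \<open>One bound for two regimes: for \<open>p \<le> 1\<close> increments are at most the value
  1 at 0, and otherwise the mean value theorem gives \<open>p * z powr (p - 1)\<close> with
  \<open>p < 2\<close> and \<open>z < n\<close>. Multiplied by \<open>n powr - p\<close> it becomes
  \<open>n powr - p + 2 / n\<close>, comparable to the variance of one mixed increment.\<close>

lemma powr_increment_le:
  fixes x n p :: real
  assumes x: "0 \<le> x" "x + 1 \<le> n" and p: "0 < p" "p < 2"
  shows "(x + 1) powr p - x powr p \<le> 1 + 2 * n powr (p - 1)"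
proof (cases "p \<le> 1")
  case True
  then have "(x + 1) powr p - x powr p \<le> 1"
    using powr_increment_antimono[of 0 x p] x p by simp
  then show ?thesis using powr_ge_zero[of n "p - 1"] by linarith
next
  case False
  have "\<exists>l z. x < z \<and> z < x + 1 \<and> ((\<lambda>z. z powr p) has_real_derivative l) (at z)
      \<and> (x + 1) powr p - x powr p = (x + 1 - x) * l"
  proof (rule MVT)
    show "continuous_on {x..x + 1} (\<lambda>z. z powr p)"
      using x p by (intro continuous_on_powr' continuous_intros) auto
    show "(\<lambda>z. z powr p) differentiable at z" if "x < z" "z < x + 1" for z
      using that x by (intro real_differentiable_def[THEN iffD2] exI[of _ "p * z powr (p - 1)"])
        (auto intro!: derivative_eq_intros)
  qed simp
  then obtain l z where z: "x < z" "z < x + 1" "((\<lambda>z. z powr p) has_real_derivative l) (at z)"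
      and eq: "(x + 1) powr p - x powr p = l" by auto
  have "((\<lambda>z. z powr p) has_real_derivative p * z powr (p - 1)) (at z)"
    using z x by (auto intro!: derivative_eq_intros)
  with z(3) have "l = p * z powr (p - 1)" by (rule DERIV_unique)
  also have "\<dots> \<le> 2 * n powr (p - 1)"
    using z x p False by (intro mult_mono powr_mono2) auto
  finally show ?thesis using eq by simp
qed

text \<open>With \<open>p = 2 * H\<close> this is the autocovariance at lag \<open>n\<close> of
  fractional Gaussian noise with unit step. The absolute value matters only at \<open>n = 0\<close>,
  where it makes the variance equal to 1.\<close>

definition fgn_cov :: "real \<Rightarrow> nat \<Rightarrow> real" where
  "fgn_cov p n = ((real n + 1) powr p + \<bar>real n - 1\<bar> powr p - 2 * real n powr p) / 2"

text \<open>The covariance at positive lag is half a second difference of \<open>n powr p\<close>,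
  nonpositive for \<open>p \<le> 1\<close> and nonnegative otherwise, so the absolute values
  telescope. The summand 1/2 covers a last increment below the first one, which is 1; the power
  covers the opposite case.\<close>

lemma sum_abs_fgn_cov_le:
  assumes N: "0 < N" and p: "0 < p" "p < 2"
  shows "(\<Sum>n\<in>{1..<N}. \<bar>fgn_cov p n\<bar>) \<le> 1 / 2 + real N powr (p - 1)"
proof -
  define f where "f n = (real n + 1) powr p - real n powr p" for n
  have r: "fgn_cov p n = (f n - f (n - 1)) / 2" if "1 \<le> n" for n
    using that by (simp add: fgn_cov_def f_def of_nat_diff)
  have tele: "(\<Sum>n\<in>{1..<Suc m}. f n - f (n - 1)) = f m - f 0" for m
    by (induction m) auto
  have "(\<Sum>n\<in>{1..<N}. \<bar>fgn_cov p n\<bar>) = \<bar>f (N - 1) - f 0\<bar> / 2"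
  proof (cases "p \<le> 1")
    case True
    have "f n \<le> f (n - 1)" for n
      unfolding f_def using True p by (intro powr_increment_antimono) auto
    then have "(\<Sum>n\<in>{1..<N}. \<bar>fgn_cov p n\<bar>) = (\<Sum>n\<in>{1..<N}. - (f n - f (n - 1)) / 2)"
      by (intro sum.cong refl) (simp add: r)
    also have "\<dots> = - (f (N - 1) - f 0) / 2"
      using tele[of "N - 1"] N by (simp add: sum_divide_distrib[symmetric] sum_negf sum_subtractf)
    also have "f (N - 1) \<le> f 0"
      unfolding f_def using True p by (intro powr_increment_antimono) auto
    then have "- (f (N - 1) - f 0) / 2 = \<bar>f (N - 1) - f 0\<bar> / 2" by simp
    finally show ?thesis .
  next
    case False
    have "f (n - 1) \<le> f n" for n
      unfolding f_def using False p by (intro powr_increment_mono) auto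
    then have "(\<Sum>n\<in>{1..<N}. \<bar>fgn_cov p n\<bar>) = (\<Sum>n\<in>{1..<N}. (f n - f (n - 1)) / 2)"
      by (intro sum.cong refl) (simp add: r)
    also have "\<dots> = (f (N - 1) - f 0) / 2"
      using tele[of "N - 1"] N by (simp add: sum_divide_distrib[symmetric])
    also have "f 0 \<le> f (N - 1)"
      unfolding f_def using False p by (intro powr_increment_mono) auto
    then have "(f (N - 1) - f 0) / 2 = \<bar>f (N - 1) - f 0\<bar> / 2" by simp
    finally show ?thesis .
  qed
  also have "\<dots> \<le> 1 / 2 + real N powr (p - 1)"
  proof -
    have "f (N - 1) \<le> 1 + 2 * real N powr (p - 1)"
      unfolding f_def using N p by (intro powr_increment_le) auto
    moreover have "0 \<le> f (N - 1)" "f 0 = 1"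
      using p powr_mono2[of p "real (N - 1)" "real (N - 1) + 1"] by (auto simp: f_def)
    moreover have "0 \<le> real N powr (p - 1)" by simp
    ultimately show ?thesis
      unfolding \<open>f 0 = 1\<close> by argo
  qed
  finally show ?thesis .
qed

text \<open>In a row of a Toeplitz matrix lag 0 occurs once and each positive lag at most twice,
  once on either side of the diagonal.\<close>

lemma sum_dist_le:
  fixes g :: "nat \<Rightarrow> real"
  assumes "i < N" and g: "\<And>n. 0 \<le> g n"
  shows "(\<Sum>j<N. g (if i \<le> j then j - i else i - j)) \<le> g 0 + 2 * (\<Sum>n\<in>{1..<N}. g n)"
proof -
  let ?d = "\<lambda>j. if i \<le> j then j - i else i - j"
  have split: "{..<N} = insert i ({..<i} \<union> {i<..<N})" using assms by auto
  have "(\<Sum>j<N. g (?d j)) = g (?d i) + (\<Sum>j\<in>{..<i} \<union> {i<..<N}. g (?d j))"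
    unfolding split by (rule sum.insert) auto
  also have "(\<Sum>j\<in>{..<i} \<union> {i<..<N}. g (?d j)) = (\<Sum>j<i. g (?d j)) + (\<Sum>j\<in>{i<..<N}. g (?d j))"
    by (rule sum.union_disjoint) auto
  also have "(\<Sum>j<i. g (?d j)) = (\<Sum>n\<in>(\<lambda>j. i - j) ` {..<i}. g n)"
    by (subst sum.reindex) (auto simp: inj_on_def intro!: sum.cong)
  also have "\<dots> \<le> (\<Sum>n\<in>{1..<N}. g n)"
    using assms by (intro sum_mono2) auto
  also have "(\<Sum>j\<in>{i<..<N}. g (?d j)) = (\<Sum>n\<in>(\<lambda>j. j - i) ` {i<..<N}. g n)"
    by (subst sum.reindex) (auto simp: inj_on_def intro!: sum.cong)
  also have "\<dots> \<le> (\<Sum>n\<in>{1..<N}. g n)"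
    using assms by (intro sum_mono2) auto
  finally show ?thesis by simp
qed

text \<open>The Brownian part gives \<open>1 / N\<close> and the fractional part at most
  \<open>2 * N powr - p + 2 / N\<close>, whence the factor 3. The row sums stay comparable to the
  diagonal even for \<open>p > 1\<close>, where the sum over lags grows with
  \<open>N\<close>.\<close>

lemma row_sum_le:
  assumes N: "0 < N" and i: "i < N" and p: "0 < p" "p < 2"
  shows "(\<Sum>j<N. \<bar>(if i = j then 1 / real N else 0)
      + real N powr - p * fgn_cov p (if i \<le> j then j - i else i - j)\<bar>)
    \<le> 3 * (1 / real N + real N powr - p)"
proof -
  let ?r = "\<lambda>j. fgn_cov p (if i \<le> j then j - i else i - j)" and ?b = "real N powr - p"
  have "(\<Sum>j<N. \<bar>(if i = j then 1 / real N else 0) + ?b * ?r j\<bar>) \<le>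
      (\<Sum>j<N. (if i = j then 1 / real N else 0) + ?b * \<bar>?r j\<bar>)"
    by (intro sum_mono order_trans[OF abs_triangle_ineq]) (auto simp: abs_mult)
  also have "\<dots> = 1 / real N + ?b * (\<Sum>j<N. \<bar>?r j\<bar>)"
    using i by (simp add: sum.distrib sum_distrib_left[symmetric])
  also have "(\<Sum>j<N. \<bar>?r j\<bar>) \<le> \<bar>fgn_cov p 0\<bar> + 2 * (\<Sum>n\<in>{1..<N}. \<bar>fgn_cov p n\<bar>)"
    using sum_dist_le[OF i, of "\<lambda>n. \<bar>fgn_cov p n\<bar>"] by simp
  also have "fgn_cov p 0 = 1"
    by (simp add: fgn_cov_def)
  also have "\<bar>1\<bar> + 2 * (\<Sum>n\<in>{1..<N}. \<bar>fgn_cov p n\<bar>) \<le> 2 + 2 * real N powr (p - 1)"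
    using sum_abs_fgn_cov_le[OF N p] by simp
  finally have "(\<Sum>j<N. \<bar>(if i = j then 1 / real N else 0) + ?b * ?r j\<bar>) \<le>
      1 / real N + ?b * (2 + 2 * real N powr (p - 1))"
    by (simp add: mult_left_mono)
  also have "?b * (2 + 2 * real N powr (p - 1)) = 2 * ?b + 2 / real N"
  proof -
    have "?b * real N powr (p - 1) = real N powr (- 1)"
      by (simp add: powr_add[symmetric])
    then show ?thesis
      using N by (simp add: distrib_left powr_minus_divide)
  qed
  also have "1 / real N + (2 * ?b + 2 / real N) \<le> 3 * (1 / real N + ?b)"
    by simp
  finally show ?thesis .
qed

text \<open>A nonnegative series with finite expected sum converges almost surely, so its terms tend
  to 0. This takes the place of Chebyshev's inequality with Borel-Cantelli.\<close>

lemma (in prob_space) AE_tendsto_zero_of_summable: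
  fixes f :: "nat \<Rightarrow> 'a \<Rightarrow> real"
  assumes int: "\<And>n. integrable M (f n)" and nn: "\<And>n \<omega>. 0 \<le> f n \<omega>"
    and sm: "summable (\<lambda>n. expectation (f n))"
  shows "AE \<omega> in M. (\<lambda>n. f n \<omega>) \<longlonglongrightarrow> 0"
proof -
  have [measurable]: "f n \<in> borel_measurable M" for n using int[of n] by auto
  have "(\<integral>\<^sup>+\<omega>. (\<Sum>n. ennreal (f n \<omega>)) \<partial>M) = (\<Sum>n. \<integral>\<^sup>+\<omega>. ennreal (f n \<omega>) \<partial>M)"
    by (rule nn_integral_suminf) simp
  also have "\<dots> = (\<Sum>n. ennreal (expectation (f n)))"
    using int nn by (simp add: nn_integral_eq_integral)
  also have "\<dots> = ennreal (\<Sum>n. expectation (f n))"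
    using sm nn by (intro suminf_ennreal2) auto
  finally have "(\<integral>\<^sup>+\<omega>. (\<Sum>n. ennreal (f n \<omega>)) \<partial>M) \<noteq> \<infinity>" by simp
  then have "AE \<omega> in M. (\<Sum>n. ennreal (f n \<omega>)) \<noteq> \<infinity>"
    by (intro nn_integral_PInf_AE) auto
  then show ?thesis
  proof eventually_elim
    case (elim \<omega>)
    then have "summable (\<lambda>n. f n \<omega>)"
      using nn by (intro summable_suminf_not_top) (auto simp: top_ennreal_def)
    then show ?case by (rule summable_LIMSEQ_zero)
  qed
qed

subsection \<open>The mixed process\<close>

definition mixed_cov :: "real \<Rightarrow> real \<Rightarrow> real \<Rightarrow> real" where
  "mixed_cov p s t = min s t + (t powr p + s powr p - \<bar>t - s\<bar> powr p) / 2"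

text \<open>In the second difference the terms in \<open>s\<close> or \<open>t\<close> alone cancel.
  The second difference of the minimum lives on the diagonal, and the powers of distances depend on
  the lag only and scale by \<open>N powr - p\<close>.\<close>

lemma mixed_cov_increments:
  fixes i j :: nat
  assumes N: "0 < N"
  shows "mixed_cov p (real (i + 1) / real N) (real (j + 1) / real N)
      - mixed_cov p (real (i + 1) / real N) (real j / real N)
      - mixed_cov p (real i / real N) (real (j + 1) / real N)
      + mixed_cov p (real i / real N) (real j / real N) =
    (if i = j then 1 / real N else 0) + real N powr - p * fgn_cov p (if i \<le> j then j - i else i - j)"
proof -
  let ?b = "real N powr - p"
  have sc: "\<bar>x / real N - y / real N\<bar> powr p = \<bar>x - y\<bar> powr p * ?b" for x y :: real
    using N by (simp add: diff_divide_distrib[symmetric] powr_divide powr_minus_divide)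
  have mn: "min (x / real N) (y / real N) = min x y / real N" for x y :: real
    using N by (simp add: min_divide_distrib_right)
  have kern: "\<bar>real (j + 1) - real i\<bar> powr p + \<bar>real j - real (i + 1)\<bar> powr p
      - \<bar>real (j + 1) - real (i + 1)\<bar> powr p - \<bar>real j - real i\<bar> powr p
      = 2 * fgn_cov p (if i \<le> j then j - i else i - j)"
  proof (cases "i \<le> j")
    case True
    then have "\<bar>real (j + 1) - real i\<bar> = real (j - i) + 1" "\<bar>real j - real (i + 1)\<bar> = \<bar>real (j - i) - 1\<bar>"
      "\<bar>real (j + 1) - real (i + 1)\<bar> = real (j - i)" "\<bar>real j - real i\<bar> = real (j - i)"
      by auto
    then show ?thesis using True by (simp only: fgn_cov_def if_True) simp
  next
    case False
    then have "\<bar>real (j + 1) - real i\<bar> = \<bar>real (i - j) - 1\<bar>" "\<bar>real j - real (i + 1)\<bar> = real (i - j) + 1"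
      "\<bar>real (j + 1) - real (i + 1)\<bar> = real (i - j)" "\<bar>real j - real i\<bar> = real (i - j)"
      by auto
    then show ?thesis using False by (simp only: fgn_cov_def if_False) simp
  qed
  have mins: "min (real (i + 1)) (real (j + 1)) - min (real (i + 1)) (real j)
      - min (real i) (real (j + 1)) + min (real i) (real j) = (if i = j then 1 else 0)"
    by (auto simp: min_def)
  have "mixed_cov p (real (i + 1) / real N) (real (j + 1) / real N)
      - mixed_cov p (real (i + 1) / real N) (real j / real N)
      - mixed_cov p (real i / real N) (real (j + 1) / real N)
      + mixed_cov p (real i / real N) (real j / real N) =
    (min (real (i + 1)) (real (j + 1)) - min (real (i + 1)) (real j)
      - min (real i) (real (j + 1)) + min (real i) (real j)) / real N
    + ?b * (\<bar>real (j + 1) - real i\<bar> powr p + \<bar>real j - real (i + 1)\<bar> powr p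
      - \<bar>real (j + 1) - real (i + 1)\<bar> powr p - \<bar>real j - real i\<bar> powr p) / 2"
    unfolding mixed_cov_def mn sc by (simp add: diff_divide_distrib add_divide_distrib algebra_simps)
  then show ?thesis unfolding mins kern by simp
qed

lemma mixed_quadratic_variation_tendsto:
  fixes B BH :: "real \<Rightarrow> 'a \<Rightarrow> real"
  assumes "prob_space M" and H: "0 < H" "H < 1"
    and B: "brownian_motion M B" and BH: "fractional_brownian_motion M H BH"
    and ind: "prob_space.indep_var M (PiM {0..} (\<lambda>_. borel)) (path B) (PiM {0..} (\<lambda>_. borel)) (path BH)"
  defines "X \<equiv> \<lambda>t \<omega>. B t \<omega> + BH t \<omega>"
  shows "AE \<omega> in M. (\<lambda>N. (\<Sum>j<N. (X (real (j + 1) / real N) \<omega> - X (real j / real N) \<omega>)\<^sup>2) /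
      (real N * (1 / real N + real N powr - (2 * H)))) \<longlonglongrightarrow> 1"
proof -
  define p where "p = 2 * H"
  have p: "0 < p" "p < 2" using H by (auto simp: p_def)
  note gp = B[unfolded brownian_motion_def] BH[unfolded fractional_brownian_motion_def, folded p_def]
  interpret gaussian_space M "linear_combinations {0..} X"
    unfolding X_def by (rule gaussian_space_indep_process_sum[OF assms(1) gp ind])
  have Xmem: "X t \<in> linear_combinations {0..} X" if "0 \<le> t" for t
    using that linear_combinations_base[of t "{0..}" X] by simp
  have cov: "expectation (\<lambda>\<omega>. X s \<omega> * X t \<omega>) = mixed_cov p s t" if st: "0 \<le> s" "0 \<le> t" for s t
    unfolding X_def mixed_cov_def
  proof (rule indep_process_sum_covariance[OF assms(1) gp ind st])
    \<comment> \<open>The fractional part of the two-point variance is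
      \<open>2 * (s powr p + t powr p) - \<bar>t - s\<bar> powr p\<close>; its sign follows because
      the distance is at most the larger of the two times.\<close>
    have "\<bar>t - s\<bar> powr p \<le> s powr p + t powr p"
    proof (cases "s \<le> t")
      case True
      then have "\<bar>t - s\<bar> powr p \<le> t powr p" using st p by (intro powr_mono2) auto
      then show ?thesis using powr_ge_zero[of s p] by linarith
    next
      case False
      then have "\<bar>t - s\<bar> powr p \<le> s powr p" using st p by (intro powr_mono2) auto
      then show ?thesis using powr_ge_zero[of t p] by linarith
    qed
    moreover have "0 \<le> s powr p" "0 \<le> t powr p" by auto
    ultimately show "0 \<le> (s powr p + s powr p - \<bar>s - s\<bar> powr p) / 2 + (t powr p + t powr p - \<bar>t - t\<bar> powr p) / 2
        + 2 * ((t powr p + s powr p - \<bar>t - s\<bar> powr p) / 2)"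
      using p by simp
  qed (use st p in \<open>auto simp: min_def abs_minus_commute add.commute\<close>)
  define Z where "Z N j \<omega> = X (real (j + 1) / real N) \<omega> - X (real j / real N) \<omega>" for N j \<omega>
  define c where "c N = 1 / real N + real N powr - p" for N
  define f where "f N \<omega> = ((\<Sum>j<N. (Z N j \<omega>)\<^sup>2) / (real N * c N) - 1) ^ 4" for N \<omega>
  have Zmem: "Z N j \<in> linear_combinations {0..} X" for N j
    unfolding Z_def[abs_def] by (intro diff_mem Xmem) auto
  have Zcov: "expectation (\<lambda>\<omega>. Z N i \<omega> * Z N j \<omega>) =
      (if i = j then 1 / real N else 0) + real N powr - p * fgn_cov p (if i \<le> j then j - i else i - j)"
    if "0 < N" for N i j
  proof -
    have int: "integrable M (\<lambda>\<omega>. X s \<omega> * X t \<omega>)" if "0 \<le> s" "0 \<le> t" for s t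
      using that by (intro integrable_mult Xmem)
    have "expectation (\<lambda>\<omega>. Z N i \<omega> * Z N j \<omega>) = expectation (\<lambda>\<omega>.
        X (real (i + 1) / real N) \<omega> * X (real (j + 1) / real N) \<omega>
        - X (real (i + 1) / real N) \<omega> * X (real j / real N) \<omega>
        - X (real i / real N) \<omega> * X (real (j + 1) / real N) \<omega>
        + X (real i / real N) \<omega> * X (real j / real N) \<omega>)"
      by (intro Bochner_Integration.integral_cong) (auto simp: Z_def algebra_simps)
    also have "\<dots> = mixed_cov p (real (i + 1) / real N) (real (j + 1) / real N)
      - mixed_cov p (real (i + 1) / real N) (real j / real N)
      - mixed_cov p (real i / real N) (real (j + 1) / real N)
      + mixed_cov p (real i / real N) (real j / real N)"
      by (simp add: int cov del: of_nat_add of_nat_Suc)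
    finally show ?thesis unfolding mixed_cov_increments[OF that] .
  qed
  have cpos: "0 < c N" if "0 < N" for N
    using that by (simp add: c_def add_pos_nonneg)
  \<comment> \<open>Row sums of at most \<open>3 * c N\<close> give the constant
    \<open>144 * 9 = 1296\<close>; all powers of \<open>c N\<close> cancel, so the rate does not
    depend on \<open>H\<close>.\<close>
  have f: "integrable M (f N) \<and> expectation (f N) \<le> 1296 / (real N)\<^sup>2" if N: "0 < N" for N
  proof -
    let ?Q = "\<lambda>\<omega>. (\<Sum>j<N. (Z N j \<omega>)\<^sup>2) - real (card {..<N}) * c N"
    have var: "expectation (\<lambda>\<omega>. (Z N j \<omega>)\<^sup>2) = c N" for j
      using Zcov[OF N, of j j] by (simp add: power2_eq_square c_def fgn_cov_def)
    have row: "(\<Sum>j<N. \<bar>expectation (\<lambda>\<omega>. Z N i \<omega> * Z N j \<omega>)\<bar>) \<le> 3 * c N" if "i \<in> {..<N}" for i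
      using row_sum_le[OF N _ p, of i] that by (simp add: Zcov[OF N] c_def)
    note mom = quadratic_variation_fourth_moment[of "{..<N}" "Z N" "c N" "3 * c N", OF _ Zmem var row]
    have fQ: "f N = (\<lambda>\<omega>. ?Q \<omega> ^ 4 / (real N * c N) ^ 4)"
      using N cpos[OF N] by (simp add: f_def power_divide[symmetric] diff_divide_distrib fun_eq_iff)
    have "expectation (f N) = expectation (\<lambda>\<omega>. ?Q \<omega> ^ 4) / (real N * c N) ^ 4"
      unfolding fQ by simp
    also have "\<dots> \<le> 144 * (3 * c N)\<^sup>2 * (real N * c N)\<^sup>2 / (real N * c N) ^ 4"
      using mom(2) by (intro divide_right_mono) auto
    also have "\<dots> = 1296 / (real N)\<^sup>2"
      using N cpos[OF N] by (simp add: field_simps power2_eq_square power4_eq_xxxx)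
    finally show ?thesis using mom(1) unfolding fQ by auto
  qed
  have "AE \<omega> in M. (\<lambda>n. f (Suc n) \<omega>) \<longlonglongrightarrow> 0"
  proof (rule AE_tendsto_zero_of_summable)
    have "summable (\<lambda>n. 1296 * (1 / real (Suc n) ^ 2))"
      using inverse_squares_sums by (intro summable_mult) (auto simp: sums_iff add.commute)
    then show "summable (\<lambda>n. expectation (f (Suc n)))"
    proof (rule summable_comparison_test'[where N = 0])
      fix n
      have "0 \<le> expectation (f (Suc n))"
        by (intro integral_nonneg_AE) (simp add: f_def)
      then show "norm (expectation (f (Suc n))) \<le> 1296 * (1 / real (Suc n) ^ 2)"
        using f[of "Suc n"] by simp
    qed
  next
    show "integrable M (f (Suc n))" for n
      using f[of "Suc n"] by simp
  qed (simp add: f_def)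
  then show ?thesis
  proof eventually_elim
    case (elim \<omega>)
    let ?V = "\<lambda>N. (\<Sum>j<N. (Z N j \<omega>)\<^sup>2) / (real N * c N)"
    have "(\<lambda>N. f N \<omega>) \<longlonglongrightarrow> 0" using elim by (subst (asm) filterlim_sequentially_Suc)
    then have "(\<lambda>N. sqrt (sqrt (f N \<omega>))) \<longlonglongrightarrow> sqrt (sqrt 0)" by (intro tendsto_intros)
    moreover have "sqrt (sqrt (x ^ 4)) = \<bar>x\<bar>" for x :: real
    proof -
      have "x ^ 4 = (x\<^sup>2)\<^sup>2" by simp
      then show ?thesis by (simp only: real_sqrt_abs abs_power2)
    qed
    ultimately have "(\<lambda>N. \<bar>?V N - 1\<bar>) \<longlonglongrightarrow> 0" by (simp add: f_def)
    then have "(\<lambda>N. ?V N - 1) \<longlonglongrightarrow> 0" by (simp only: tendsto_rabs_zero_iff)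
    then have "?V \<longlonglongrightarrow> 1" by (simp only: LIM_zero_iff)
    then show ?case by (simp add: Z_def c_def p_def)
  qed
qed

section \<open>The drift and the price process\<close>

text \<open>The increments are nonnegative, telescope to 2, the value of \<open>t + t powr p\<close>
  at 1, and are each at most \<open>3 * (1 / N + N powr - p)\<close>; the sum of squares is at most
  this bound times the sum.\<close>

lemma drift_square_sum_le:
  fixes N :: nat
  assumes N: "0 < N" and p: "0 < p" "p < 2"
  defines "d \<equiv> \<lambda>j. real (j + 1) / real N + (real (j + 1) / real N) powr p
      - (real j / real N + (real j / real N) powr p)"
  shows "(\<Sum>j<N. (d j)\<^sup>2) \<le> 6 * (1 / real N + real N powr - p)"
proof -
  let ?b = "real N powr - p"
  let ?g = "\<lambda>j. real j / real N + (real j / real N) powr p"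
  have d: "d j = 1 / real N + ?b * ((real j + 1) powr p - real j powr p)" for j
  proof -
    have sc: "(x / real N) powr p = ?b * x powr p" if "0 \<le> x" for x
      using that by (simp add: powr_divide powr_minus_divide)
    have "(real (j + 1) / real N) powr p = ?b * (real j + 1) powr p"
      using sc[of "real (j + 1)"] by (simp add: add.commute)
    then show ?thesis
      by (simp add: d_def sc add_divide_distrib right_diff_distrib)
  qed
  have nn: "0 \<le> d j" for j
    unfolding d using p by (intro add_nonneg_nonneg mult_nonneg_nonneg) (auto intro!: powr_mono2)
  have le: "d j \<le> 3 * (1 / real N + ?b)" if "j < N" for j
  proof -
    have "?b * ((real j + 1) powr p - real j powr p) \<le> ?b * (1 + 2 * real N powr (p - 1))"
      using that p by (intro mult_left_mono powr_increment_le) auto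
    also have "\<dots> = ?b + 2 / real N"
    proof -
      have "?b * real N powr (p - 1) = real N powr (- 1)"
        by (simp add: powr_add[symmetric])
      then show ?thesis
        using N by (simp add: distrib_left powr_minus_divide)
    qed
    finally have "d j \<le> 3 * (1 / real N) + ?b" unfolding d by simp
    then show ?thesis using powr_ge_zero[of "real N" "- p"] by argo
  qed
  have "(\<Sum>j<N. d j) = (\<Sum>j<N. ?g (Suc j) - ?g j)"
    by (simp add: d_def)
  also have "\<dots> = ?g N - ?g 0" by (rule sum_lessThan_telescope)
  also have "\<dots> = 2" using N p by simp
  finally have sum: "(\<Sum>j<N. d j) = 2" .
  have "(\<Sum>j<N. (d j)\<^sup>2) \<le> (\<Sum>j<N. 3 * (1 / real N + ?b) * d j)"
    using le nn by (intro sum_mono) (auto simp: power2_eq_square intro!: mult_right_mono)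
  also have "\<dots> = 6 * (1 / real N + ?b)"
    by (simp add: sum_distrib_left[symmetric] sum)
  finally show ?thesis .
qed

text \<open>The logarithm of a price ratio is a noise increment minus a drift increment, and the
  positive factor \<open>S0\<close> cancels. At \<open>N = 0\<close> both sums are empty, so the
  identity holds for every \<open>N\<close>.\<close>

lemma sigma_hat_sq_eq:
  fixes B BH :: "real \<Rightarrow> 'a \<Rightarrow> real" and H \<sigma> S0 :: real
  assumes S0: "0 < S0"
  defines "X \<equiv> \<lambda>t \<omega>. B t \<omega> + BH t \<omega>" and "p \<equiv> 2 * H"
  shows "sigma_hat_sq H (gmfbm_price S0 \<sigma> H B BH) N \<omega> =
    (\<Sum>j<N. (\<sigma> * (X (real (j + 1) / real N) \<omega> - X (real j / real N) \<omega>)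
       - \<sigma>\<^sup>2 / 2 * (real (j + 1) / real N + (real (j + 1) / real N) powr p
          - (real j / real N + (real j / real N) powr p)))\<^sup>2)
     / (real N * (1 / real N + real N powr - p))"
proof -
  have ln_ratio: "ln (gmfbm_price S0 \<sigma> H B BH t \<omega> / gmfbm_price S0 \<sigma> H B BH s \<omega>) =
      \<sigma> * (X t \<omega> - X s \<omega>) - \<sigma>\<^sup>2 / 2 * (t + t powr p - (s + s powr p))" for s t
    using S0 by (simp add: gmfbm_price_def X_def p_def exp_diff[symmetric] right_diff_distrib)
  show ?thesis
    unfolding sigma_hat_sq_def ln_ratio p_def powr_minus_divide
    by (simp only: divide_inverse inverse_mult_distrib mult_1_left mult_ac)
qed

theorem theorem1:
  fixes M :: "'a measure" and B BH :: "real \<Rightarrow> 'a \<Rightarrow> real"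
    and H \<sigma> S0 :: real
  assumes "prob_space M"
    and "0 < H" "H < 1" "0 < \<sigma>" "0 < S0"
    and "brownian_motion M B"
    and "fractional_brownian_motion M H BH"
    and "prob_space.indep_var M (PiM {0..} (\<lambda>_. borel)) (path B)
                                (PiM {0..} (\<lambda>_. borel)) (path BH)"
  shows "AE \<omega> in M.
           (\<lambda>N. sigma_hat_sq H (gmfbm_price S0 \<sigma> H B BH) N \<omega>) \<longlonglongrightarrow> \<sigma>\<^sup>2"
proof -
  define p where "p = 2 * H"
  have p: "0 < p" "p < 2" using assms(2,3) by (auto simp: p_def)
  define d where "d N j = real (j + 1) / real N + (real (j + 1) / real N) powr p
      - (real j / real N + (real j / real N) powr p)" for N j
  define a where "a N = real N * (1 / real N + real N powr - p)" for N
  define D where "D N = (\<Sum>j<N. (d N j)\<^sup>2) / a N" for N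
  have apos: "0 < a N" if "0 < N" for N
    using that by (simp add: a_def add_pos_nonneg)
  have D: "D \<longlonglongrightarrow> 0"
  proof (rule tendsto_sandwich[OF _ _ tendsto_const])
    show "\<forall>\<^sub>F N in sequentially. 0 \<le> D N"
      using eventually_gt_at_top[of 0]
      by eventually_elim (use apos in \<open>auto simp: D_def intro!: divide_nonneg_pos sum_nonneg\<close>)
    show "\<forall>\<^sub>F N in sequentially. D N \<le> 6 * (1 / real N)"
      using eventually_gt_at_top[of 0]
    proof eventually_elim
      case (elim N)
      have "D N \<le> 6 * (1 / real N + real N powr - p) / a N"
        unfolding D_def d_def using apos[OF elim] drift_square_sum_le[OF elim p]
        by (intro divide_right_mono) auto
      also have "\<dots> = 6 * (1 / real N)"
        unfolding a_def using apos[OF elim] unfolding a_def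
        by (subst mult_divide_mult_cancel_right) auto
      finally show ?case .
    qed
    show "(\<lambda>N. 6 * (1 / real N)) \<longlonglongrightarrow> 0"
      using tendsto_mult_right_zero[OF lim_1_over_n] by simp
  qed
  show ?thesis
    using mixed_quadratic_variation_tendsto[OF assms(1,2,3,6,7,8)]
  proof eventually_elim
    case (elim \<omega>)
    define z where "z N j = (B (real (j + 1) / real N) \<omega> + BH (real (j + 1) / real N) \<omega>)
      - (B (real j / real N) \<omega> + BH (real j / real N) \<omega>)" for N j
    define V where "V N = (\<Sum>j<N. (z N j)\<^sup>2) / a N" for N
    define C where "C N = (\<Sum>j<N. z N j * d N j) / a N" for N
    have V: "V \<longlonglongrightarrow> 1"
      using elim by (simp add: V_def[abs_def] z_def a_def p_def)
    have "(\<lambda>N. C N) \<longlonglongrightarrow> 0"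
    proof (rule Lim_null_comparison)
      show "\<forall>\<^sub>F N in sequentially. norm (C N) \<le> sqrt (V N * D N)"
      \<comment> \<open>At \<open>N = 0\<close> the three quotients are all 0, so the Cauchy-Schwarz
        bound holds for every \<open>N\<close>.\<close>
      proof (intro always_eventually allI)
        fix N
        have "(C N)\<^sup>2 \<le> V N * D N"
          using Cauchy_Schwarz_ineq_sum[of "z N" "d N" "{..<N}"]
          by (simp add: C_def V_def D_def power_divide power2_eq_square[of "a N"] divide_right_mono)
        then show "norm (C N) \<le> sqrt (V N * D N)"
          by (simp add: real_le_rsqrt)
      qed
      have "(\<lambda>N. sqrt (V N * D N)) \<longlonglongrightarrow> sqrt (1 * 0)"
        by (intro tendsto_intros V D)
      then show "(\<lambda>N. sqrt (V N * D N)) \<longlonglongrightarrow> 0" by simp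
    qed
    \<comment> \<open>The coefficients come from expanding the square of
      \<open>\<sigma> * z - \<sigma>\<^sup>2 / 2 * d\<close>; the cross term has
      \<open>2 * \<sigma> * \<sigma>\<^sup>2 / 2 = \<sigma> ^ 3\<close>.\<close>
    then have "(\<lambda>N. \<sigma>\<^sup>2 * V N - \<sigma> ^ 3 * C N + \<sigma> ^ 4 / 4 * D N) \<longlonglongrightarrow> \<sigma>\<^sup>2 * 1 - \<sigma> ^ 3 * 0 + \<sigma> ^ 4 / 4 * 0"
      by (intro tendsto_intros V D)
    moreover have "sigma_hat_sq H (gmfbm_price S0 \<sigma> H B BH) N \<omega> = \<sigma>\<^sup>2 * V N - \<sigma> ^ 3 * C N + \<sigma> ^ 4 / 4 * D N" for N
    proof -
      have "sigma_hat_sq H (gmfbm_price S0 \<sigma> H B BH) N \<omega> =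
          (\<Sum>j<N. (\<sigma> * z N j - \<sigma>\<^sup>2 / 2 * d N j)\<^sup>2) / a N"
        unfolding sigma_hat_sq_eq[OF assms(5)] z_def d_def a_def p_def ..
      also have "(\<Sum>j<N. (\<sigma> * z N j - \<sigma>\<^sup>2 / 2 * d N j)\<^sup>2) =
          (\<Sum>j<N. \<sigma>\<^sup>2 * (z N j)\<^sup>2 - \<sigma> ^ 3 * (z N j * d N j) + \<sigma> ^ 4 / 4 * (d N j)\<^sup>2)"
        by (intro sum.cong refl) (simp add: power2_eq_square power3_eq_cube power4_eq_xxxx algebra_simps)
      also have "\<dots> / a N = \<sigma>\<^sup>2 * V N - \<sigma> ^ 3 * C N + \<sigma> ^ 4 / 4 * D N"
        unfolding V_def C_def D_def sum.distrib sum_subtractf sum_distrib_left[symmetric]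
        by (simp add: add_divide_distrib diff_divide_distrib)
      finally show ?thesis .
    qed
    ultimately show ?case by simp
  qed
qed

end
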